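(* Let $\Delta\subset\mathbb R^m$ be a full-dimensional simplex and $\mathbf c\in\mathbb R^m$ a generic direction (i.e. $\langle\mathbf c,\mathbf u\rangle\ne\langle\mathbf c,\mathbf v\rangle$ for all distinct vertices $\mathbf u,\mathbf v$ of $\Delta$). Then the slope map $\theta:\mathbb R^m\to\mathbb R^m$ is a piecewise linear isomorphism from the pivot fan $\mathcal F(\Delta,\mathbf c)$ to the sylvester fan $\mathcal F_m$.
   Context: Label the $n=m+1$ vertices of $\Delta$ as $\mathbf u_1,\dots,\mathbf u_n$ with $\langle\mathbf c,\mathbf u_i\rangle<\langle\mathbf c,\mathbf u_j\rangle$ for $i<j$. A vertex $\mathbf v$ is an improving neighbor of $\mathbf u$ if $\langle\mathbf c,\mathbf u\rangle<\langle\mathbf c,\mathbf v\rangle$ (all pairs of vertices of a simplex are edges). For distinct vertices $\mathbf u,\mathbf v$ and $\boldsymbol\omega\in\mathbb R^m$ set $\rho^{\boldsymbol\omega}(\mathbf u,\mathbf v)=\frac{\langle\boldsymbol\omega,\mathbf v-\mathbf u\rangle}{\langle\mathbf c,\mathbf v-\mathbf u\rangle}$ and $\tau^{\boldsymbol\omega}(\mathbf u)=\max\{\rho^{\boldsymbol\omega}(\mathbf u,\mathbf v):\mathbf v\text{ improving neighbor of }\mathbf u\}$ for $\mathbf u\ne\mathbf u_n$ (with $\tau^{\boldsymbol\omega}(\mathbf u_n)=-\infty$). A direction $\boldsymbol\omega$ linearly independent of $\mathbf c$ is generic if for every $\mathbf u\ne\mathbf u_n$ the maximum is attained by a unique improving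 neighbor $\mathcal A^{\boldsymbol\omega}(\mathbf u)$ (and $\mathcal A^{\boldsymbol\omega}(\mathbf u_n)=\mathbf u_n$). The pivot fan $\mathcal F(\Delta,\mathbf c)$ is the complete polyhedral fan in $\mathbb R^m$ whose maximal cones are the closures of the fibers of $\boldsymbol\omega\mapsto\mathcal A^{\boldsymbol\omega}$ on generic $\boldsymbol\omega$. The slope map is $\theta(\boldsymbol\omega)=(\tau^{\boldsymbol\omega}(\mathbf u_i))_{i\in[m]}\in\mathbb R^m$. For a permutation $\pi$ of $[m]$ let $C(\pi)=\{\mathbf x\in\mathbb R^m:x_{\pi_1}<\dots<x_{\pi_m}\}$. The sylvester congruence $\equiv_{\mathrm{sylv}}$ is the equivalence relation on permutations of $[m]$ generated by $UjVikW\equiv_{\mathrm{sylv}}UjVkiW$ for letters $1\le i<j<k\le m$ and words $U,V,W$. The sylvester fan $\mathcal F_m$ is the fan in $\mathbb R^m$ whose maximal cones are the closures of the unions of the regions $C(\pi)$ over the permutations $\pi$ in one sylvester congruence class (it is the normal fan of Loday's associahedron, up to central symmetry). A piecewise linear isomorphism from a fan $\mathcal F$ to a fan $\mathcal G$ is a continuous bijection that is linear on each cone of $\mathcal F$ and maps the cones of $\mathcal F$ bijectively onto the cones of $\mathcal G$. *)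

theory Defs
  imports "HOL-Analysis.Analysis" "HOL-Combinatorics.Multiset_Permutations"
begin

text \<open>
  The space \<open>\<real>\<^sup>m\<close> is \<open>real ^ 'm\<close>, where the finite linearly ordered type \<open>'m\<close> plays the role of
  \<open>[m]\<close>: the element \<open>i :: 'm\<close> stands for the number \<open>pos i\<close>, which ranges over \<open>{1..m}\<close>.
\<close>

definition pos :: "'m::{finite,linorder} \<Rightarrow> nat" where
  "pos i = card {..i}"


subsection \<open>Fans\<close>

definition polyhedral_fan :: "'a::euclidean_space set set \<Rightarrow> bool" where
  "polyhedral_fan F \<longleftrightarrow>
     finite F \<and>
     (\<forall>\<sigma>\<in>F. polyhedron \<sigma> \<and> cone \<sigma> \<and> \<sigma> \<noteq> {}) \<and>
     (\<forall>\<sigma>\<in>F. \<forall>\<tau>. \<tau> face_of \<sigma> \<and> \<tau> \<noteq> {} \<longrightarrow> \<tau> \<in> F) \<and>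
     (\<forall>\<sigma>\<in>F. \<forall>\<tau>\<in>F. (\<sigma> \<inter> \<tau>) face_of \<sigma> \<and> (\<sigma> \<inter> \<tau>) face_of \<tau>)"

definition complete_fan :: "'a::euclidean_space set set \<Rightarrow> bool" where
  "complete_fan F \<longleftrightarrow> polyhedral_fan F \<and> \<Union>F = UNIV"

text \<open>
  A complete fan is determined by its maximal cones: it consists of all their nonempty faces
  (\<open>{}\<close> is a face in the sense of \<open>face_of\<close> but not a cone). That the resulting family really is a
  complete fan is not assumed; it is a part of \<open>pl_fan_isomorphism\<close> below.
\<close>

definition fan_of :: "'a::euclidean_space set set \<Rightarrow> 'a set set" where
  "fan_of M = {\<tau>. \<tau> \<noteq> {} \<and> (\<exists>\<sigma>\<in>M. \<tau> face_of \<sigma>)}"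

definition pl_fan_isomorphism ::
    "('a::euclidean_space \<Rightarrow> 'b::euclidean_space) \<Rightarrow> 'a set set \<Rightarrow> 'b set set \<Rightarrow> bool" where
  "pl_fan_isomorphism f F G \<longleftrightarrow>
     complete_fan F \<and> complete_fan G \<and>
     continuous_on UNIV f \<and> bij f \<and>
     (\<forall>\<sigma>\<in>F. \<exists>g. linear g \<and> (\<forall>x\<in>\<sigma>. f x = g x)) \<and>
     bij_betw (\<lambda>\<sigma>. f ` \<sigma>) F G"


subsection \<open>The pivot fan\<close>

definition vertices :: "'a::euclidean_space set \<Rightarrow> 'a set" where
  "vertices \<Delta> = {v. v extreme_point_of \<Delta>}"

text \<open>All pairs of vertices of a simplex are edges, so every vertex is a neighbor of every other.\<close>

definition improving_neighbors ::
    "'a::euclidean_space set \<Rightarrow> 'a \<Rightarrow> 'a \<Rightarrow> 'a set" where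
  "improving_neighbors \<Delta> c u = {v \<in> vertices \<Delta>. c \<bullet> u < c \<bullet> v}"

definition slope :: "'a::euclidean_space \<Rightarrow> 'a \<Rightarrow> 'a \<Rightarrow> 'a \<Rightarrow> real" where
  "slope c \<omega> u v = (\<omega> \<bullet> (v - u)) / (c \<bullet> (v - u))"

text \<open>
  The vertex with the largest value of \<open>c\<close> is the one without improving neighbors.
\<close>

definition max_slope :: "'a::euclidean_space set \<Rightarrow> 'a \<Rightarrow> 'a \<Rightarrow> 'a \<Rightarrow> ereal" where
  "max_slope \<Delta> c \<omega> u =
     (if improving_neighbors \<Delta> c u = {} then - \<infinity>
      else ereal (Max (slope c \<omega> u ` improving_neighbors \<Delta> c u)))"

text \<open>
  Linear independence of \<open>\<omega>\<close> from \<open>c\<close> is written \<open>\<omega> \<notin> span {c}\<close>; here \<open>c \<noteq> 0\<close> always holds.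
  (\<open>independent {\<omega>, c}\<close> would not exclude \<open>\<omega> = c\<close>.) In dimension \<open>1\<close> no direction is generic, so
  the pivot fan only makes sense for \<open>m \<ge> 2\<close>.
\<close>

definition generic_direction :: "'a::euclidean_space set \<Rightarrow> 'a \<Rightarrow> 'a \<Rightarrow> bool" where
  "generic_direction \<Delta> c \<omega> \<longleftrightarrow>
     \<omega> \<notin> span {c} \<and>
     (\<forall>u\<in>vertices \<Delta>. improving_neighbors \<Delta> c u \<noteq> {} \<longrightarrow>
        (\<exists>!v. v \<in> improving_neighbors \<Delta> c u \<and> ereal (slope c \<omega> u v) = max_slope \<Delta> c \<omega> u))"

definition arborescence :: "'a::euclidean_space set \<Rightarrow> 'a \<Rightarrow> 'a \<Rightarrow> 'a \<Rightarrow> 'a" where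
  "arborescence \<Delta> c \<omega> u =
     (if improving_neighbors \<Delta> c u = {} then u
      else THE v. v \<in> improving_neighbors \<Delta> c u \<and> ereal (slope c \<omega> u v) = max_slope \<Delta> c \<omega> u)"

text \<open>
  The fiber of \<open>\<omega> \<mapsto> arborescence \<Delta> c \<omega>\<close> through \<open>\<omega>\<close>, where arborescences are maps on \<open>vertices \<Delta>\<close>.
\<close>

definition pivot_fiber :: "'a::euclidean_space set \<Rightarrow> 'a \<Rightarrow> 'a \<Rightarrow> 'a set" where
  "pivot_fiber \<Delta> c \<omega> =
     {\<omega>'. generic_direction \<Delta> c \<omega>' \<and>
          (\<forall>u\<in>vertices \<Delta>. arborescence \<Delta> c \<omega>' u = arborescence \<Delta> c \<omega> u)}"

definition pivot_fan :: "'a::euclidean_space set \<Rightarrow> 'a \<Rightarrow> 'a set set" where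
  "pivot_fan \<Delta> c = fan_of {closure (pivot_fiber \<Delta> c \<omega>) |\<omega>. generic_direction \<Delta> c \<omega>}"

text \<open>
  Here \<open>u 1, u 2, \<dots>\<close> are the vertices of \<open>\<Delta>\<close> labeled increasingly with respect to \<open>c\<close>. The
  coordinates only involve \<open>u 1, \<dots>, u m\<close>, not the top vertex, so \<open>max_slope\<close> is finite there.
\<close>

definition slope_map ::
    "(real ^ 'm::{finite,linorder}) set \<Rightarrow> real ^ 'm::{finite,linorder} \<Rightarrow>
     (nat \<Rightarrow> real ^ 'm::{finite,linorder}) \<Rightarrow> real ^ 'm::{finite,linorder} \<Rightarrow>
     real ^ 'm::{finite,linorder}"
  where
  "slope_map \<Delta> c u \<omega> = (\<chi> i. real_of_ereal (max_slope \<Delta> c \<omega> (u (pos i))))"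


subsection \<open>The sylvester fan\<close>

text \<open>
  Permutations of \<open>[m]\<close> are words, i.e. lists in which every element of \<open>'m\<close> occurs exactly once.
\<close>

inductive sylvester_step :: "'m::{finite,linorder} list \<Rightarrow> 'm list \<Rightarrow> bool" where
  "i < j \<Longrightarrow> j < k \<Longrightarrow> U @ [j] @ V @ [i, k] @ W \<in> permutations_of_set UNIV \<Longrightarrow>
   sylvester_step (U @ [j] @ V @ [i, k] @ W) (U @ [j] @ V @ [k, i] @ W)"

definition sylvester_class :: "'m::{finite,linorder} list \<Rightarrow> 'm list set" where
  "sylvester_class \<pi> = {\<sigma> \<in> permutations_of_set UNIV. equivclp sylvester_step \<pi> \<sigma>}"

definition region :: "'m::{finite,linorder} list \<Rightarrow> (real ^ 'm::{finite,linorder}) set" where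
  "region \<pi> = {x. sorted_wrt (<) (map (\<lambda>i. x $ i) \<pi>)}"

definition sylvester_fan :: "(real ^ 'm::{finite,linorder}) set set" where
  "sylvester_fan =
     fan_of {closure (\<Union>\<sigma>\<in>sylvester_class \<pi>. region \<sigma>) |\<pi>. \<pi> \<in> permutations_of_set UNIV}"

end

theory Submission
  imports Defs
begin

text \<open>
  Both fans are governed by the Cartesian tree of \<open>x \<in> \<real>\<^sup>m\<close>, in which \<open>p\<close> is an ancestor of \<open>q\<close>
  when \<open>x\<close> takes its minimum over the interval between \<open>p\<close> and \<open>q\<close> at \<open>p\<close>. A sylvester class
  consists of the linear extensions of one such tree, so its closed cone is cut out by the inequalities
  \<open>y\<^sub>p \<le> y\<^sub>q\<close> for these pairs. On the other side, the steepest improving neighbor of \<open>u\<^sub>i\<close> is \<open>u\<^sub>j\<close> for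
  the first \<open>j > i\<close> with \<open>\<theta>\<^sub>j < \<theta>\<^sub>i\<close> (and the top vertex if there is none): the slopes along an upper
  convex hull decrease. Thus the arborescence is the Cartesian tree of \<open>\<theta>(\<omega>)\<close>, and on the preimage of
  each cone \<open>\<theta>\<close> agrees with the linear isomorphism given by the slopes along the tree edges.
  Bijectivity holds because \<open>h\<^sub>i = max\<^bsub>j > i\<^esub> (h\<^sub>j - \<theta>\<^sub>i (c\<^sub>j - c\<^sub>i))\<close> recovers the heights \<open>h\<^sub>i = \<langle>\<omega>, u\<^sub>i\<rangle>\<close>
  from \<open>\<theta>\<close> downwards.
\<close>

section \<open>Cones of Cartesian trees\<close>

text \<open>With ties in \<open>x\<close> both orientations of a pair can occur, which makes \<open>tree_cone x\<close> a lower-dimensional cone.\<close>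

definition minimal_pairs :: "real ^ 'm::{finite,linorder} \<Rightarrow> ('m \<times> 'm) set" where
  "minimal_pairs x = {(p, q). \<forall>k\<in>{min p q..max p q}. x $ p \<le> x $ k}"

definition tree_cone :: "real ^ 'm::{finite,linorder} \<Rightarrow> (real ^ 'm::{finite,linorder}) set" where
  "tree_cone x = {y. \<forall>(p, q)\<in>minimal_pairs x. y $ p \<le> y $ q}"

section \<open>Tree cones as polyhedral cones\<close>

lemma minimal_pairsD: "(p, q) \<in> minimal_pairs x \<Longrightarrow> x $ p \<le> x $ q"
  by (auto simp: minimal_pairs_def)

lemma minimal_pairs_between:
  "(p, q) \<in> minimal_pairs x \<Longrightarrow> k \<in> {min p q..max p q} \<Longrightarrow> (p, k) \<in> minimal_pairs x"
  by (fastforce simp: minimal_pairs_def min_def max_def split: if_splits)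

lemma tree_coneD: "y \<in> tree_cone x \<Longrightarrow> (p, q) \<in> minimal_pairs x \<Longrightarrow> y $ p \<le> y $ q"
  by (auto simp: tree_cone_def)

text \<open>If \<open>p\<close> is minimal up to \<open>q\<close>, it is also minimal up to every
  index in between, so the single inequalities at \<open>y\<close> add up to minimality over the
  whole interval. Membership thus becomes an inclusion of sets, which makes containment of tree
  cones transitive.\<close>

lemma tree_cone_iff: "y \<in> tree_cone x \<longleftrightarrow> minimal_pairs x \<subseteq> minimal_pairs y"
proof
  assume y: "y \<in> tree_cone x"
  show "minimal_pairs x \<subseteq> minimal_pairs y"
  proof (intro subrelI)
    fix p q assume "(p, q) \<in> minimal_pairs x"
    then have "\<forall>k\<in>{min p q..max p q}. y $ p \<le> y $ k"
      using minimal_pairs_between tree_coneD[OF y] by blast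
    then show "(p, q) \<in> minimal_pairs y" by (simp add: minimal_pairs_def)
  qed
next
  assume "minimal_pairs x \<subseteq> minimal_pairs y"
  then show "y \<in> tree_cone x"
    by (auto simp: tree_cone_def dest: minimal_pairsD)
qed

lemma tree_cone_self: "x \<in> tree_cone x"
  by (simp add: tree_cone_iff)

lemma tree_cone_subset_iff: "tree_cone y \<subseteq> tree_cone x \<longleftrightarrow> y \<in> tree_cone x"
  using tree_cone_self by (force simp: tree_cone_iff)

lemma finite_range_tree_cone: "finite (range (tree_cone :: real ^ 'm::{finite,linorder} \<Rightarrow> _))"
proof -
  have "finite ((\<lambda>P. {y :: real ^ 'm::{finite,linorder}. \<forall>(p, q)\<in>P. y $ p \<le> y $ q}) ` UNIV)"
    by (rule finite_imageI) simp
  then show ?thesis by (rule rev_finite_subset) (auto simp: tree_cone_def)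
qed

lemma tree_cone_eq_Inter:
  "tree_cone x = (\<Inter>(p, q)\<in>minimal_pairs x. {y. (axis q 1 - axis p 1) \<bullet> y \<ge> 0})"
  by (auto simp: tree_cone_def inner_diff_left inner_axis' split: prod.splits)

lemma polyhedron_tree_cone: "polyhedron (tree_cone x)"
  unfolding tree_cone_eq_Inter
  by (rule polyhedron_Inter) (auto intro: polyhedron_halfspace_ge)

lemma closed_tree_cone: "closed (tree_cone x)"
  by (simp add: polyhedron_imp_closed polyhedron_tree_cone)

lemma convex_tree_cone: "convex (tree_cone x)"
  by (simp add: polyhedron_imp_convex polyhedron_tree_cone)

lemma cone_tree_cone: "cone (tree_cone x)"
  by (auto simp: cone_def tree_cone_def intro: mult_left_mono)

lemma zero_in_tree_cone: "0 \<in> tree_cone x"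
  by (auto simp: tree_cone_def)

lemma tree_cone_add: "y \<in> tree_cone x \<Longrightarrow> z \<in> tree_cone x \<Longrightarrow> y + z \<in> tree_cone x"
  by (fastforce simp: tree_cone_def intro: add_mono)

text \<open>The minimizer \<open>r\<close> is the lowest common ancestor of \<open>p\<close> and
  \<open>q\<close> in the tree of \<open>x\<close>. It dominates the whole interval because the
  interval from \<open>r\<close> to any \<open>k\<close> stays inside.\<close>

lemma interval_argmin:
  fixes x :: "real ^ 'm::{finite,linorder}" and p q :: 'm
  obtains r where "r \<in> {min p q..max p q}"
    "\<And>k. k \<in> {min p q..max p q} \<Longrightarrow> (r, k) \<in> minimal_pairs x"
proof -
  let ?I = "{min p q..max p q}"
  have "p \<in> ?I" by simp
  then have "finite ?I" "?I \<noteq> {}" by (simp, blast)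
  then obtain r where r: "r \<in> ?I" "\<And>k. k \<in> ?I \<Longrightarrow> x $ r \<le> x $ k"
    using ex_min_if_finite[of "(\<lambda>k. x $ k) ` ?I"]
    by (metis (no_types, lifting) arg_min_if_finite(1) arg_min_least)
  have "(r, k) \<in> minimal_pairs x" if k: "k \<in> ?I" for k
  proof -
    have "{min r k..max r k} \<subseteq> ?I" using r(1) k by (auto simp: min_def max_def split: if_splits)
    then show ?thesis using r(2) unfolding minimal_pairs_def by blast
  qed
  with r(1) show thesis by (rule that)
qed

text \<open>A pair tied at \<open>z\<close> is minimal for \<open>z\<close> in both orientations,
  which forces the tie on all of \<open>tree_cone z\<close>. Conversely, a minimal pair of
  \<open>z\<close> is compared through the lowest common ancestor \<open>r\<close> in the tree of
  \<open>x\<close>: it is tied with \<open>p\<close> at \<open>z\<close>, hence at \<open>y\<close>,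
  and lies below \<open>q\<close> at \<open>y\<close>.\<close>

lemma tree_cone_face_eq:
  assumes z: "z \<in> tree_cone x"
  shows "tree_cone z =
    tree_cone x \<inter> {y. \<forall>(p, q)\<in>minimal_pairs x. z $ p = z $ q \<longrightarrow> y $ p = y $ q}"
    (is "_ = ?F")
proof (intro subset_antisym subsetI)
  fix y assume y: "y \<in> tree_cone z"
  have "y $ p = y $ q" if pq: "(p, q) \<in> minimal_pairs x" "z $ p = z $ q" for p q
  proof -
    have a: "(p, q) \<in> minimal_pairs z" using z pq(1) by (auto simp: tree_cone_iff)
    then have "(q, p) \<in> minimal_pairs z"
      using pq(2) by (simp add: minimal_pairs_def min.commute max.commute)
    with a show ?thesis using tree_coneD[OF y] by (meson antisym)
  qed
  moreover have "y \<in> tree_cone x" using y z by (auto simp: tree_cone_iff)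
  ultimately show "y \<in> ?F" by auto
next
  fix y assume y: "y \<in> ?F"
  show "y \<in> tree_cone z" unfolding tree_cone_def
  proof (safe)
    fix p q assume pq: "(p, q) \<in> minimal_pairs z"
    obtain r where r: "r \<in> {min p q..max p q}"
      "\<And>k. k \<in> {min p q..max p q} \<Longrightarrow> (r, k) \<in> minimal_pairs x"
      using interval_argmin[of p q x] by blast
    have rp: "(r, p) \<in> minimal_pairs x" and rq: "(r, q) \<in> minimal_pairs x"
      by (intro r(2); simp)+
    have "z $ r \<le> z $ p" using rp z by (rule tree_coneD[rotated])
    moreover have "z $ p \<le> z $ r" using pq r(1) by (simp add: minimal_pairs_def)
    ultimately have "y $ r = y $ p" using y rp by auto
    moreover have "y $ r \<le> y $ q" using y rq tree_coneD by blast
    ultimately show "y $ p \<le> y $ q" by simp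
  qed
qed

text \<open>The sum of all inequalities tight at \<open>z\<close> is one functional, nonnegative on
  \<open>tree_cone x\<close>; it vanishes exactly where every summand does, so it supports the face
  found in \<open>tree_cone_face_eq\<close>.\<close>

lemma tree_cone_face_of:
  fixes x z :: "real ^ 'm::{finite,linorder}"
  assumes z: "z \<in> tree_cone x"
  shows "tree_cone z face_of tree_cone x"
proof -
  define E where "E = {(p, q)\<in>minimal_pairs x. z $ p = z $ q}"
  define a :: "real ^ 'm::{finite,linorder}" where "a = (\<Sum>(p, q)\<in>E. axis q 1 - axis p 1)"
  have a: "a \<bullet> y = (\<Sum>(p, q)\<in>E. y $ q - y $ p)" for y
    unfolding a_def inner_sum_left
    by (intro sum.cong) (auto simp: inner_diff_left inner_axis')
  have ge: "0 \<le> y $ q - y $ p" if "y \<in> tree_cone x" "(p, q) \<in> E" for y p q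
    using that tree_coneD by (fastforce simp: E_def)
  have "tree_cone z = tree_cone x \<inter> {y. a \<bullet> y = 0}"
  proof -
    have "(a \<bullet> y = 0) = (\<forall>(p, q)\<in>E. y $ q - y $ p = 0)" if "y \<in> tree_cone x" for y
      unfolding a using ge[OF that] by (subst sum_nonneg_eq_0_iff) auto
    then show ?thesis unfolding tree_cone_face_eq[OF z] by (fastforce simp: E_def)
  qed
  moreover have "a \<bullet> y \<ge> 0" if "y \<in> tree_cone x" for y
    unfolding a using ge[OF that] by (intro sum_nonneg) auto
  ultimately show ?thesis
    using face_of_Int_supporting_hyperplane_ge[OF convex_tree_cone, where b = 0 and a = a] by metis
qed

text \<open>In effect \<open>x\<close> is a relative interior point of its own cone: a segment from
  \<open>y\<close> can be prolonged beyond \<open>x\<close>. Pairs strict at \<open>x\<close>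
  survive a short step, and pairs tied at \<open>x\<close> are minimal in both orientations, hence
  tied at \<open>y\<close> too. Treating the finitely many pairs one by one only shrinks
  \<open>e\<close>.\<close>

lemma tree_cone_extend:
  assumes y: "y \<in> tree_cone x"
  obtains e where "e > 0" "x + e *\<^sub>R (x - y) \<in> tree_cone x"
proof -
  have "\<exists>e>0. \<forall>s\<in>P. x $ fst s + e * (x $ fst s - y $ fst s) \<le> x $ snd s + e * (x $ snd s - y $ snd s)"
    if "P \<subseteq> minimal_pairs x" for P
    using finite_subset[OF that finite] that
  proof (induction P rule: finite_induct)
    case empty
    then show ?case by (auto intro: exI[of _ 1])
  next
    case (insert s P)
    obtain p q where s: "s = (p, q)" by (cases s)
    from insert obtain e where e: "e > 0" "\<forall>s\<in>P. x $ fst s + e * (x $ fst s - y $ fst s) \<le> x $ snd s + e * (x $ snd s - y $ snd s)"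
      by auto
    have pq: "(p, q) \<in> minimal_pairs x" using insert s by auto
    define d where "d = y $ q - y $ p"
    have d: "d \<ge> 0" using tree_coneD[OF y pq] by (simp add: d_def)
    have le: "x $ p \<le> x $ q" using pq by (rule minimal_pairsD)
    show ?case
    proof (cases "x $ p = x $ q")
      case True
      then have "(q, p) \<in> minimal_pairs x"
        using pq by (simp add: minimal_pairs_def min.commute max.commute)
      then have "y $ q \<le> y $ p" by (rule tree_coneD[OF y])
      then have "y $ p = y $ q" using d d_def by simp
      then show ?thesis using e True s by auto
    next
      case False
      \<comment> \<open>The denominator \<open>d + 1\<close> keeps the quotient positive also when
        \<open>d = 0\<close>.\<close>
      define e' where "e' = min e ((x $ q - x $ p) / (d + 1))"
      have e': "e' > 0" "e' \<le> e" using e(1) le False d by (auto simp: e'_def)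
      have "e' * d \<le> e' * (d + 1)" using e' by (simp add: mult_left_mono)
      also have "\<dots> \<le> (x $ q - x $ p) / (d + 1) * (d + 1)"
        using d by (intro mult_right_mono) (auto simp: e'_def)
      also have "\<dots> = x $ q - x $ p" using d by simp
      finally have 1: "e' * d \<le> x $ q - x $ p" .
      have "e' * (x $ q - x $ p) \<ge> 0" using e' le by simp
      with 1 have 2: "x $ p + e' * (x $ p - y $ p) \<le> x $ q + e' * (x $ q - y $ q)"
        by (simp add: d_def algebra_simps)
      have "x $ fst t + e' * (x $ fst t - y $ fst t) \<le> x $ snd t + e' * (x $ snd t - y $ snd t)"
        if t: "t \<in> P" for t
      proof -
        have xt: "x $ fst t \<le> x $ snd t" using t insert.prems minimal_pairsD[of "fst t" "snd t" x] by auto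
        define D where "D = (x $ snd t - y $ snd t) - (x $ fst t - y $ fst t)"
        have "0 \<le> (x $ snd t - x $ fst t) + e * D" using e(2) t by (auto simp: D_def algebra_simps)
        \<comment> \<open>The slack is affine in the step length and nonnegative at \<open>0\<close>
          and at \<open>e\<close>, hence at \<open>e'\<close> in between.\<close>
        then have "0 \<le> (x $ snd t - x $ fst t) + e' * D"
        proof (cases "D \<ge> 0")
          case True then show ?thesis using xt e' by simp
        next
          case False
          then have "e * D \<le> e' * D" using e' by (intro mult_right_mono_neg) auto
          with \<open>0 \<le> _ + e * D\<close> show ?thesis by simp
        qed
        then show ?thesis by (simp add: D_def algebra_simps)
      qed
      with 2 e' s show ?thesis by (intro exI[of _ e']) auto
    qed
  qed
  from this[OF order_refl] obtain e where e: "e > 0" "\<forall>s\<in>minimal_pairs x. x $ fst s + e * (x $ fst s - y $ fst s) \<le> x $ snd s + e * (x $ snd s - y $ snd s)"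
    by auto
  then have "x + e *\<^sub>R (x - y) \<in> tree_cone x" by (auto simp: tree_cone_def)
  with e(1) show thesis by (rule that)
qed

text \<open>By \<open>tree_cone_extend\<close>, \<open>x\<close> lies in an open segment of the cone
  starting at an arbitrary \<open>y\<close>, so the face must contain \<open>y\<close>.\<close>

lemma face_of_tree_cone_containing:
  assumes F: "F face_of tree_cone x" and x: "x \<in> F"
  shows "F = tree_cone x"
proof (intro subset_antisym subsetI)
  fix y assume "y \<in> F" then show "y \<in> tree_cone x" using F face_of_imp_subset by blast
next
  fix y assume y: "y \<in> tree_cone x"
  obtain e where e: "e > 0" "x + e *\<^sub>R (x - y) \<in> tree_cone x"
    using tree_cone_extend[OF y] by blast
  show "y \<in> F"
  proof (cases "x = y")
    case True then show ?thesis using x by simp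
  next
    case False
    define z where "z = x + e *\<^sub>R (x - y)"
    have "x = (1 - 1 / (1 + e)) *\<^sub>R y + (1 / (1 + e)) *\<^sub>R z"
    proof -
      have "(1 + e) *\<^sub>R x = e *\<^sub>R y + z" by (simp add: z_def algebra_simps)
      then have "(1 / (1 + e)) *\<^sub>R ((1 + e) *\<^sub>R x) = (1 / (1 + e)) *\<^sub>R (e *\<^sub>R y + z)" by simp
      moreover have "(1 - 1 / (1 + e)) = e / (1 + e)" using e(1) by (simp add: field_simps)
      ultimately show ?thesis using e(1) by (simp add: scaleR_right_distrib)
    qed
    moreover have "y \<noteq> z"
    proof
      assume "y = z"
      then have "(1 + e) *\<^sub>R (x - y) = 0" by (simp add: z_def algebra_simps)
      then show False using e(1) False by simp
    qed
    moreover have "0 < 1 / (1 + e)" "1 / (1 + e) < 1" using e(1) by auto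
    ultimately have "x \<in> open_segment y z" unfolding in_segment by blast
    then show ?thesis using face_ofD[OF F(1), of x y z] x y e(2) z_def by blast
  qed
qed

text \<open>A relative interior point \<open>z\<close> of the face generates it: \<open>F\<close>
  lies in the face \<open>tree_cone z\<close>, and as a face of \<open>tree_cone z\<close>
  containing \<open>z\<close> it is everything.\<close>

lemma face_of_tree_cone:
  assumes F: "F face_of tree_cone x" "F \<noteq> {}"
  shows "F \<in> range tree_cone"
proof -
  have "convex F" using F(1) face_of_imp_convex convex_tree_cone by blast
  then obtain z where z: "z \<in> rel_interior F" using F(2) rel_interior_eq_empty by blast
  then have zF: "z \<in> F" using rel_interior_subset by blast
  then have zx: "z \<in> tree_cone x" using F(1) face_of_imp_subset by blast
  have sub: "F \<subseteq> tree_cone z"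
  proof (rule subset_of_face_of[OF tree_cone_face_of[OF zx]])
    show "F \<subseteq> tree_cone x" using F(1) by (rule face_of_imp_subset)
    show "tree_cone z \<inter> rel_interior F \<noteq> {}"
      using z tree_cone_self by blast
  qed
  moreover have "tree_cone z \<subseteq> tree_cone x" using zx by (simp add: tree_cone_subset_iff)
  ultimately have "F face_of tree_cone z" using F(1) face_of_subset by blast
  from face_of_tree_cone_containing[OF this zF] show ?thesis by blast
qed

text \<open>The intersection is again the tree cone of any of its relative interior points
  \<open>z\<close>, and that cone is a face because \<open>z\<close> lies in
  \<open>tree_cone x\<close>.\<close>

lemma tree_cone_Int_face_of: "tree_cone x \<inter> tree_cone y face_of tree_cone x"
proof -
  let ?S = "tree_cone x \<inter> tree_cone y"
  have "convex ?S" by (simp add: convex_Int convex_tree_cone)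
  moreover have "?S \<noteq> {}" using zero_in_tree_cone by blast
  ultimately obtain z where z: "z \<in> rel_interior ?S" using rel_interior_eq_empty by blast
  then have zx: "z \<in> tree_cone x" and zy: "z \<in> tree_cone y" using rel_interior_subset by blast+
  have "?S \<subseteq> tree_cone z"
    by (rule subset_of_face_of[OF tree_cone_face_of[OF zx]])
       (use z tree_cone_self in auto)
  moreover have "tree_cone z \<subseteq> ?S" using zx zy by (simp add: tree_cone_subset_iff)
  ultimately show ?thesis using tree_cone_face_of[OF zx] by (metis subset_antisym)
qed

section \<open>The complete fan of all tree cones\<close>

lemma complete_fan_tree_cones: "complete_fan (range (tree_cone :: real ^ 'm::{finite,linorder} \<Rightarrow> _))"
  unfolding complete_fan_def polyhedral_fan_def
proof (intro conjI ballI allI impI)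
  show "finite (range (tree_cone :: real ^ 'm::{finite,linorder} \<Rightarrow> _))" by (rule finite_range_tree_cone)
  show "\<Union> (range (tree_cone :: real ^ 'm::{finite,linorder} \<Rightarrow> _)) = UNIV" using tree_cone_self by blast
next
  fix \<sigma> :: "(real ^ 'm::{finite,linorder}) set"
  assume "\<sigma> \<in> range tree_cone"
  then show "polyhedron \<sigma>" "cone \<sigma>" "\<sigma> \<noteq> {}"
    using polyhedron_tree_cone cone_tree_cone tree_cone_self by auto
next
  fix \<sigma> \<tau> :: "(real ^ 'm::{finite,linorder}) set"
  assume "\<sigma> \<in> range tree_cone" "\<tau> face_of \<sigma> \<and> \<tau> \<noteq> {}"
  then show "\<tau> \<in> range tree_cone" using face_of_tree_cone by auto
next
  fix \<sigma> \<tau> :: "(real ^ 'm::{finite,linorder}) set"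
  assume "\<sigma> \<in> range tree_cone" "\<tau> \<in> range tree_cone"
  then show "\<sigma> \<inter> \<tau> face_of \<sigma>" "\<sigma> \<inter> \<tau> face_of \<tau>"
    by (auto simp: tree_cone_Int_face_of) (metis Int_commute tree_cone_Int_face_of)
qed

text \<open>A member of \<open>M\<close> containing \<open>x\<close> has \<open>tree_cone x\<close>
  as a face. Both fans are identified through this criterion, which only asks that the maximal cones
  are tree cones covering the space.\<close>

lemma fan_of_tree_cones:
  fixes M :: "(real ^ 'm::{finite,linorder}) set set"
  assumes "M \<subseteq> range tree_cone" "\<Union>M = UNIV"
  shows "fan_of M = range tree_cone"
proof (intro subset_antisym subsetI)
  fix \<tau> assume "\<tau> \<in> fan_of M"
  then show "\<tau> \<in> range tree_cone" using assms(1) face_of_tree_cone by (auto simp: fan_of_def)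
next
  fix \<tau> :: "(real ^ 'm::{finite,linorder}) set"
  assume "\<tau> \<in> range tree_cone"
  then obtain x where \<tau>: "\<tau> = tree_cone x" by blast
  obtain \<sigma> where \<sigma>: "\<sigma> \<in> M" "x \<in> \<sigma>" using assms(2) by blast
  then have "tree_cone x face_of \<sigma>" using assms(1) tree_cone_face_of by auto
  then show "\<tau> \<in> fan_of M" using \<sigma> \<tau> tree_cone_self by (auto simp: fan_of_def)
qed

section \<open>The sylvester fan\<close>

abbreviation distinct_coords :: "real ^ 'm::{finite,linorder} \<Rightarrow> bool" where
  "distinct_coords x \<equiv> inj (\<lambda>i. x $ i)"

section \<open>Permutations, regions and tie-breaking\<close>

lemma minimal_pairs_cong:
  assumes "\<And>p q. x $ p \<le> x $ q \<longleftrightarrow> z $ p \<le> z $ q"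
  shows "minimal_pairs x = minimal_pairs z"
  using assms by (simp add: minimal_pairs_def)

lemma perm_UNIV: "\<pi> \<in> permutations_of_set UNIV \<longleftrightarrow> set \<pi> = UNIV \<and> distinct \<pi>"
  by (auto simp: permutations_of_set_def)

lemma region_nth_less:
  assumes "\<pi> \<in> permutations_of_set UNIV" "x \<in> region \<pi>" "i < length \<pi>" "j < length \<pi>"
  shows "x $ (\<pi> ! i) < x $ (\<pi> ! j) \<longleftrightarrow> i < j"
proof -
  have *: "x $ (\<pi> ! i) < x $ (\<pi> ! j)" if "i < j" "j < length \<pi>" for i j
    using assms(2) that sorted_wrt_nth_less[of "(<)" "map (\<lambda>i. x $ i) \<pi>" i j]
    by (simp add: region_def)
  show ?thesis using *[of i j] *[of j i] assms by (cases i j rule: linorder_cases) auto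
qed

lemma region_less_cong:
  assumes "\<pi> \<in> permutations_of_set UNIV" "x \<in> region \<pi>" "z \<in> region \<pi>"
  shows "x $ p < x $ q \<longleftrightarrow> z $ p < z $ q"
proof -
  have "p \<in> set \<pi>" "q \<in> set \<pi>" using assms(1) by (auto simp: perm_UNIV)
  then obtain i j where "i < length \<pi>" "p = \<pi> ! i" "j < length \<pi>" "q = \<pi> ! j"
    by (auto simp: in_set_conv_nth)
  then show ?thesis using region_nth_less assms by metis
qed

lemma region_minimal_pairs_cong:
  assumes "\<pi> \<in> permutations_of_set UNIV" "x \<in> region \<pi>" "z \<in> region \<pi>"
  shows "minimal_pairs x = minimal_pairs z"
  by (rule minimal_pairs_cong) (metis region_less_cong[OF assms] not_le)

lemma region_distinct_coords:
  assumes "\<pi> \<in> permutations_of_set UNIV" "x \<in> region \<pi>"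
  shows "distinct_coords x"
proof (rule injI)
  fix p q assume eq: "x $ p = x $ q"
  have "p \<in> set \<pi>" "q \<in> set \<pi>" using assms(1) by (auto simp: perm_UNIV)
  then obtain i j where "i < length \<pi>" "p = \<pi> ! i" "j < length \<pi>" "q = \<pi> ! j"
    by (auto simp: in_set_conv_nth)
  then show "p = q" using eq region_nth_less[OF assms]
    by (metis less_irrefl linorder_neqE_nat)
qed

lemma region_nonempty:
  assumes "\<pi> \<in> permutations_of_set UNIV"
  obtains x where "x \<in> region \<pi>"
proof
  have d: "distinct \<pi>" using assms by (simp add: perm_UNIV)
  \<comment> \<open>The coordinate of a letter is its position in the word, counted from
    \<open>0\<close>.\<close>
  let ?x = "\<chi> i. real (inv_into {..<length \<pi>} ((!) \<pi>) i)"
  have "?x $ (\<pi> ! k) = real k" if "k < length \<pi>" for k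
    using that d by (simp add: inv_into_f_f inj_on_nth)
  then show "?x \<in> region \<pi>" by (auto simp: region_def sorted_wrt_iff_nth_less)
qed

lemma exists_sorting_perm:
  fixes x :: "real ^ 'm::{finite,linorder}"
  obtains \<pi> where "\<pi> \<in> permutations_of_set UNIV" "sorted (map (\<lambda>i. x $ i) \<pi>)"
proof
  let ?p = "sort_key (\<lambda>i. x $ i) (sorted_list_of_set UNIV)"
  show "?p \<in> permutations_of_set UNIV" "sorted (map (\<lambda>i. x $ i) ?p)"
    by (auto simp: perm_UNIV)
qed

lemma exists_region:
  assumes "distinct_coords x"
  obtains \<pi> where "\<pi> \<in> permutations_of_set UNIV" "x \<in> region \<pi>"
proof -
  obtain \<pi> where \<pi>: "\<pi> \<in> permutations_of_set UNIV" "sorted (map (\<lambda>i. x $ i) \<pi>)"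
    by (rule exists_sorting_perm)
  have "distinct (map (\<lambda>i. x $ i) \<pi>)"
    using \<pi>(1) assms by (auto simp: perm_UNIV distinct_map intro: inj_on_subset)
  then have "x \<in> region \<pi>" using \<pi>(2) by (simp add: region_def strict_sorted_iff)
  with \<pi>(1) show thesis by (rule that)
qed

text \<open>Sorting \<open>y\<close> refines its weak order to a linear one, realized by
  \<open>x\<close>. With \<open>tie_break_tree_cone\<close>, every point lies in the tree cone of a
  point with distinct coordinates.\<close>

lemma tie_break:
  fixes y :: "real ^ 'm::{finite,linorder}"
  obtains x where "distinct_coords x" "\<And>p q. y $ p < y $ q \<Longrightarrow> x $ p < x $ q"
proof -
  obtain \<pi> where \<pi>: "\<pi> \<in> permutations_of_set UNIV" "sorted (map (\<lambda>i. y $ i) \<pi>)"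
    by (rule exists_sorting_perm)
  obtain x where x: "x \<in> region \<pi>" using region_nonempty[OF \<pi>(1)] by blast
  have "x $ p < x $ q" if "y $ p < y $ q" for p q
  proof -
    have "p \<in> set \<pi>" "q \<in> set \<pi>" using \<pi>(1) by (auto simp: perm_UNIV)
    then obtain i j where ij: "i < length \<pi>" "p = \<pi> ! i" "j < length \<pi>" "q = \<pi> ! j"
      by (auto simp: in_set_conv_nth)
    have "\<not> j \<le> i" using \<pi>(2) ij that sorted_nth_mono[OF \<pi>(2), of j i] by auto
    then show ?thesis using region_nth_less[OF \<pi>(1) x] ij by simp
  qed
  with region_distinct_coords[OF \<pi>(1) x] show thesis by (rule that)
qed

lemma tie_break_tree_cone:
  fixes x y :: "real ^ 'm::{finite,linorder}"
  assumes "\<And>p q. y $ p < y $ q \<Longrightarrow> x $ p < x $ q"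
  shows "y \<in> tree_cone x"
proof -
  have "y $ p \<le> y $ q" if "(p, q) \<in> minimal_pairs x" for p q
    using assms[of q p] minimal_pairsD[OF that] by linarith
  then show ?thesis by (auto simp: tree_cone_def)
qed

text \<open>The points with distinct coordinates in one such cone share one tree: the minimizer
  \<open>r\<close> of \<open>x\<close> on an interval satisfies \<open>z $ r = z $ p\<close> as soon
  as \<open>p\<close> is minimal for \<open>z\<close>, so distinctness gives
  \<open>r = p\<close>.\<close>

lemma tree_cone_distinct_eq:
  assumes x: "distinct_coords x" and z: "distinct_coords z" "z \<in> tree_cone x"
  shows "minimal_pairs z = minimal_pairs x"
proof
  show "minimal_pairs x \<subseteq> minimal_pairs z" using z(2) by (simp add: tree_cone_iff)
  show "minimal_pairs z \<subseteq> minimal_pairs x"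
  proof (intro subrelI)
    fix p q assume pq: "(p, q) \<in> minimal_pairs z"
    obtain r where r: "r \<in> {min p q..max p q}"
      "\<And>k. k \<in> {min p q..max p q} \<Longrightarrow> (r, k) \<in> minimal_pairs x"
      using interval_argmin[of p q x] by blast
    have "(r, p) \<in> minimal_pairs x" by (intro r(2)) simp
    then have "z $ r \<le> z $ p" using z(2) tree_coneD by blast
    moreover have "z $ p \<le> z $ r" using pq r(1) by (simp add: minimal_pairs_def)
    ultimately have "r = p" using z(1) by (meson antisym injD)
    moreover have "(r, q) \<in> minimal_pairs x" by (intro r(2)) simp
    ultimately show "(p, q) \<in> minimal_pairs x" by simp
  qed
qed

text \<open>Adding small multiples of \<open>x\<close> to \<open>y\<close> stays in the cone, and
  each pair of indices is tied for at most one of the multiples.\<close>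

lemma tree_cone_closure_distinct:
  assumes x: "distinct_coords x"
  shows "tree_cone x \<subseteq> closure {z \<in> tree_cone x. distinct_coords z}"
proof
  fix y assume y: "y \<in> tree_cone x"
  define f where "f n = y + inverse (real (Suc n)) *\<^sub>R x" for n
  have "(\<lambda>n. inverse (real (Suc n)) *\<^sub>R x) \<longlonglongrightarrow> 0 *\<^sub>R x"
    by (intro tendsto_intros LIMSEQ_inverse_real_of_nat)
  then have lim: "f \<longlonglongrightarrow> y" unfolding f_def by (auto intro: tendsto_eq_intros)
  have cone: "f n \<in> tree_cone x" for n
    unfolding f_def using cone_tree_cone tree_cone_self y
    by (intro tree_cone_add mem_cone) auto
  have "eventually (\<lambda>n. f n $ p \<noteq> f n $ q) sequentially" if "p \<noteq> q" for p q
  proof -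
    have "finite {n. f n $ p = f n $ q}"
    proof (rule finite_subset[OF _ finite_atMost])
      have "n = k" if "f n $ p = f n $ q" "f k $ p = f k $ q" for n k
      proof -
        have "x $ p \<noteq> x $ q" using x \<open>p \<noteq> q\<close> by (meson injD)
        moreover have "inverse (real (Suc m)) * (x $ p - x $ q) = y $ q - y $ p"
          if "f m $ p = f m $ q" for m
          using that by (simp add: f_def algebra_simps)
        ultimately have "inverse (real (Suc n)) = inverse (real (Suc k))"
          using that by (metis eq_iff_diff_eq_0 mult_right_cancel)
        then show ?thesis by simp
      qed
      \<comment> \<open>At most one \<open>n\<close> gives a tie; if there is one,
        \<open>SOME\<close> selects it, and otherwise the bound is irrelevant.\<close>
      then show "{n. f n $ p = f n $ q} \<subseteq> {..(SOME n. f n $ p = f n $ q)}"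
        by (smt (verit) atMost_iff mem_Collect_eq order_refl some_eq_ex subsetI)
    qed
    then show ?thesis
      by (simp add: cofinite_eq_sequentially[symmetric] eventually_cofinite)
  qed
  then have "eventually (\<lambda>n. \<forall>p q. p \<noteq> q \<longrightarrow> f n $ p \<noteq> f n $ q) sequentially"
    by (auto simp: eventually_all_finite)
  then have ev: "eventually (\<lambda>n. f n \<in> {z \<in> tree_cone x. distinct_coords z}) sequentially"
    by eventually_elim (use cone in \<open>auto intro!: injI\<close>)
  have ev': "eventually (\<lambda>n. f n \<in> closure {z \<in> tree_cone x. distinct_coords z}) sequentially"
    using ev by (rule eventually_mono) (rule subsetD[OF closure_subset])
  show "y \<in> closure {z \<in> tree_cone x. distinct_coords z}"
    by (rule Lim_in_closed_set[OF closed_closure ev' _ lim]) simp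
qed

section \<open>Exchanging two adjacent letters\<close>

lemma region_swap:
  fixes a b :: "'m::{finite,linorder}"
  assumes perm: "A @ [a, b] @ W \<in> permutations_of_set UNIV" and x: "x \<in> region (A @ [a, b] @ W)"
  shows "(\<chi> i. x $ (Transposition.transpose a b i)) \<in> region (A @ [b, a] @ W)"
proof -
  have nin: "a \<notin> set A" "b \<notin> set A" "a \<notin> set W" "b \<notin> set W" "a \<noteq> b"
    using perm by (auto simp: perm_UNIV)
  let ?x = "\<chi> i. x $ (Transposition.transpose a b i)"
  have "map (\<lambda>i. ?x $ i) A = map (\<lambda>i. x $ i) A" "map (\<lambda>i. ?x $ i) W = map (\<lambda>i. x $ i) W"
    using nin by (auto simp: Transposition.transpose_def)
  moreover have "?x $ b = x $ a" "?x $ a = x $ b" by simp_all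
  ultimately show ?thesis using x unfolding region_def by (simp del: vec_lambda_beta map_eq_conv)
qed

lemma perm_swap:
  "A @ [a, b] @ W \<in> permutations_of_set UNIV \<longleftrightarrow> A @ [b, a] @ W \<in> permutations_of_set UNIV"
  by (auto simp: perm_UNIV)

text \<open>Since \<open>a\<close> and \<open>b\<close> are adjacent in the word, no other
  coordinate has a value between theirs, so exchanging the two values affects only the comparison of
  \<open>a\<close> with \<open>b\<close>.\<close>

lemma region_swap_le:
  fixes a b :: "'m::{finite,linorder}"
  assumes perm: "A @ [a, b] @ W \<in> permutations_of_set UNIV" and x: "x \<in> region (A @ [a, b] @ W)"
    and le: "x $ p \<le> x $ q" "\<not> (p = a \<and> q = b)"
  shows "x $ Transposition.transpose a b p \<le> x $ Transposition.transpose a b q"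
proof -
  have all: "i \<in> set A \<or> i = a \<or> i = b \<or> i \<in> set W" for i
    using perm by (auto simp: perm_UNIV)
  have "\<forall>i\<in>set A. x $ i < x $ a \<and> x $ i < x $ b" "x $ a < x $ b"
    "\<forall>i\<in>set W. x $ a < x $ i \<and> x $ b < x $ i"
    using x by (auto simp: region_def sorted_wrt_append)
  then show ?thesis using le all[of p] all[of q] by (auto simp: Transposition.transpose_def)
qed

lemma minimal_pairs_swap_subset:
  fixes a b :: "'m::{finite,linorder}"
  assumes perm: "A @ [a, b] @ W \<in> permutations_of_set UNIV"
    and j: "j \<in> set A" "min a b < j" "j < max a b"
    and x: "x \<in> region (A @ [a, b] @ W)" and z: "z \<in> region (A @ [b, a] @ W)"
  shows "minimal_pairs x \<subseteq> minimal_pairs z"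
proof -
  define x' where "x' = (\<chi> i. x $ (Transposition.transpose a b i))"
  have x': "x' \<in> region (A @ [b, a] @ W)" unfolding x'_def by (rule region_swap[OF perm x])
  have s: "\<forall>i\<in>set A. x $ i < x $ a \<and> x $ i < x $ b" "x $ a < x $ b"
    "\<forall>i\<in>set W. x $ a < x $ i \<and> x $ b < x $ i"
    using x by (auto simp: region_def sorted_wrt_append)
  have ord: "x' $ p \<le> x' $ k" if "x $ p \<le> x $ k" "\<not> (p = a \<and> k = b)" for p k
    using region_swap_le[OF perm x that] by (simp add: x'_def)
  have "minimal_pairs x \<subseteq> minimal_pairs x'"
  proof (intro subrelI)
    fix p q assume pq: "(p, q) \<in> minimal_pairs x"
    have "x' $ p \<le> x' $ k" if k: "k \<in> {min p q..max p q}" for k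
    proof (rule ord)
      show "x $ p \<le> x $ k" using pq k by (simp add: minimal_pairs_def)
      show "\<not> (p = a \<and> k = b)"
      proof
        assume "p = a \<and> k = b"
        then have "j \<in> {min p q..max p q}"
          using k j by (auto simp: min_def max_def split: if_splits)
        then have "x $ p \<le> x $ j" using pq by (simp add: minimal_pairs_def)
        then show False using \<open>p = a \<and> k = b\<close> s j by force
      qed
    qed
    then show "(p, q) \<in> minimal_pairs x'" by (simp add: minimal_pairs_def)
  qed
  also have "minimal_pairs x' = minimal_pairs z"
    by (rule region_minimal_pairs_cong[OF iffD1[OF perm_swap perm] x' z])
  finally show ?thesis .
qed

lemma minimal_pairs_swap:
  fixes a b :: "'m::{finite,linorder}"
  assumes "A @ [a, b] @ W \<in> permutations_of_set UNIV"
    and "j \<in> set A" "min a b < j" "j < max a b"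
    and "x \<in> region (A @ [a, b] @ W)" and "z \<in> region (A @ [b, a] @ W)"
  shows "minimal_pairs x = minimal_pairs z"
proof
  show "minimal_pairs x \<subseteq> minimal_pairs z" by (rule minimal_pairs_swap_subset[OF assms])
  show "minimal_pairs z \<subseteq> minimal_pairs x"
    using assms by (intro minimal_pairs_swap_subset[OF iffD1[OF perm_swap assms(1)] assms(2)])
      (simp_all add: min.commute max.commute)
qed

lemma sylvester_step_minimal_pairs:
  assumes "sylvester_step \<pi> \<sigma>" "x \<in> region \<pi>" "z \<in> region \<sigma>"
  shows "minimal_pairs x = minimal_pairs z"
  using assms
proof (cases rule: sylvester_step.cases)
  case (1 i j k U V W)
  then show ?thesis
    using minimal_pairs_swap[of "U @ [j] @ V" i k W j x z] assms by auto
qed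

lemma sylvester_step_perm:
  "sylvester_step \<pi> \<sigma> \<Longrightarrow> \<pi> \<in> permutations_of_set UNIV \<and> \<sigma> \<in> permutations_of_set UNIV"
  by (induction rule: sylvester_step.induct) (auto simp: perm_UNIV)

lemma sylvester_equiv_minimal_pairs:
  assumes "equivclp sylvester_step \<pi> \<sigma>" "\<pi> \<in> permutations_of_set UNIV"
    "x \<in> region \<pi>" "z \<in> region \<sigma>"
  shows "minimal_pairs x = minimal_pairs z"
proof -
  have "\<sigma> \<in> permutations_of_set UNIV \<and> (\<forall>z\<in>region \<sigma>. minimal_pairs x = minimal_pairs z)"
    using assms(1)
  proof (induction rule: equivclp_induct)
    case base
    then show ?case using assms region_minimal_pairs_cong by blast
  next
    case (step \<sigma> \<rho>)
    then have perm: "\<rho> \<in> permutations_of_set UNIV" using sylvester_step_perm by blast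
    \<comment> \<open>A point of the intermediate region links the two comparisons.\<close>
    obtain w where w: "w \<in> region \<sigma>" using region_nonempty step.IH by blast
    have "minimal_pairs x = minimal_pairs z" if "z \<in> region \<rho>" for z
      using step w that sylvester_step_minimal_pairs by metis
    with perm show ?case by blast
  qed
  then show ?thesis using assms by blast
qed

text \<open>
  Adjacent letters of \<open>\<pi>\<close> in the opposite order to \<open>\<sigma>\<close> are incomparable in the common tree, so a smaller
  letter separates them and swapping them is a sylvester step that removes an inversion.
\<close>

lemma minimal_pairs_eq_imp_sylvester_equiv:
  assumes "\<pi> \<in> permutations_of_set UNIV" "\<sigma> \<in> permutations_of_set UNIV"
    "x \<in> region \<pi>" "z \<in> region \<sigma>" "minimal_pairs x = minimal_pairs z"
  shows "equivclp sylvester_step \<pi> \<sigma>"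
  using assms
\<comment> \<open>The measure counts the pairs ordered oppositely by \<open>x\<close> and
  \<open>z\<close>, that is, the inversions between the two words.\<close>
proof (induction "card {(p, q). x $ p < x $ q \<and> z $ q < z $ p}" arbitrary: x \<pi> rule: less_induct)
  case less
  let ?inv = "\<lambda>x. {(p, q). x $ p < x $ q \<and> z $ q < z $ p}"
  have zd: "distinct_coords z" using region_distinct_coords less.prems by blast
  show ?case
  proof (cases "sorted (map (\<lambda>i. z $ i) \<pi>)")
    case True
    have "sorted (map (\<lambda>i. z $ i) \<sigma>)"
      using less.prems by (simp add: region_def strict_sorted_imp_sorted)
    moreover have "distinct (map (\<lambda>i. z $ i) \<pi>)" "distinct (map (\<lambda>i. z $ i) \<sigma>)"
      using less.prems zd by (auto simp: perm_UNIV distinct_map intro: inj_on_subset)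
    moreover have "set (map (\<lambda>i. z $ i) \<pi>) = set (map (\<lambda>i. z $ i) \<sigma>)"
      using less.prems by (simp add: perm_UNIV)
    ultimately have "map (\<lambda>i. z $ i) \<pi> = map (\<lambda>i. z $ i) \<sigma>"
      using True sorted_distinct_set_unique by blast
    then have "\<pi> = \<sigma>" using zd map_injective by blast
    then show ?thesis by simp
  next
    case False
    then obtain n where n: "Suc n < length \<pi>" "z $ (\<pi> ! Suc n) < z $ (\<pi> ! n)"
      by (auto simp: sorted_iff_nth_Suc not_le)
    define a b A W where "a = \<pi> ! n" and "b = \<pi> ! Suc n" and "A = take n \<pi>"
      and "W = drop (Suc (Suc n)) \<pi>"
    have \<pi>: "\<pi> = A @ [a, b] @ W"
      unfolding a_def b_def A_def W_def using n(1)
      by (metis Cons_eq_appendI Cons_nth_drop_Suc Suc_lessD append_self_conv2 append_take_drop_id)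
    have zba: "z $ b < z $ a" using n(2) by (simp add: a_def b_def)
    define x' where "x' = (\<chi> i. x $ (Transposition.transpose a b i))"
    have perm: "A @ [a, b] @ W \<in> permutations_of_set UNIV" using less.prems(1) by (simp only: \<pi>)
    then have perm': "A @ [b, a] @ W \<in> permutations_of_set UNIV" by (rule iffD1[OF perm_swap])
    have x: "x \<in> region (A @ [a, b] @ W)" using less.prems(3) by (simp only: \<pi>)
    have x': "x' \<in> region (A @ [b, a] @ W)" unfolding x'_def by (rule region_swap[OF perm x])
    have all: "i \<in> set A \<or> i = a \<or> i = b \<or> i \<in> set W" for i
      using perm by (auto simp: perm_UNIV)
    have s: "\<forall>i\<in>set A. x $ i < x $ a \<and> x $ i < x $ b" "x $ a < x $ b"
      "\<forall>i\<in>set W. x $ a < x $ i \<and> x $ b < x $ i"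
      using x by (auto simp: region_def sorted_wrt_append)
    have "(a, b) \<notin> minimal_pairs x"
      using zba less.prems(5) minimal_pairsD[of a b z] by auto
    then obtain j where j: "j \<in> {min a b..max a b}" "x $ j < x $ a"
      by (auto simp: minimal_pairs_def not_le)
    then have "j \<noteq> a" "j \<noteq> b" using s by auto
    then have jb: "min a b < j" "j < max a b" using j(1) by (auto simp: min_def max_def split: if_splits)
    have jA: "j \<in> set A" using all[of j] j(2) \<open>j \<noteq> a\<close> \<open>j \<noteq> b\<close> s(3) by auto
    then obtain U V where A: "A = U @ [j] @ V" by (metis append_Cons append_Nil split_list)
    \<comment> \<open>A sylvester step is directed from increasing to decreasing adjacent letters,
      so its direction depends on whether \<open>a < b\<close>.\<close>
    have "sylvester_step \<pi> (A @ [b, a] @ W) \<or> sylvester_step (A @ [b, a] @ W) \<pi>"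
    proof (cases "a < b")
      case True
      then show ?thesis
        using jb sylvester_step.intros[of a j b U V W] perm by (auto simp: \<pi> A)
    next
      case False
      then show ?thesis
        using jb sylvester_step.intros[of b j a U V W] perm' by (auto simp: \<pi> A)
    qed
    then have 1: "equivclp sylvester_step \<pi> (A @ [b, a] @ W)"
      by (auto simp: equivclp_def symclp_def)
    have ord: "x $ p < x $ q" if "x' $ p < x' $ q" "\<not> (p = b \<and> q = a)" for p q
      using region_swap_le[OF perm x, of q p] that by (force simp: x'_def)
    have "?inv x' \<subset> ?inv x"
    proof
      show "?inv x' \<subseteq> ?inv x"
      proof clarsimp
        fix p q assume "x' $ p < x' $ q" "z $ q < z $ p"
        then show "x $ p < x $ q" using zba by (intro ord) auto
      qed
      have "(a, b) \<in> ?inv x" using s zba by simp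
      moreover have "(a, b) \<notin> ?inv x'" using s by (simp add: x'_def)
      ultimately show "?inv x' \<noteq> ?inv x" by blast
    qed
    then have "card (?inv x') < card (?inv x)" by (simp add: psubset_card_mono)
    moreover have "minimal_pairs x = minimal_pairs x'"
      using minimal_pairs_swap[OF perm jA jb x x'] .
    ultimately have "equivclp sylvester_step (A @ [b, a] @ W) \<sigma>"
      using less.hyps[of x' "A @ [b, a] @ W"] perm' less.prems x' by simp
    with 1 show ?thesis by (rule equivclp_trans)
  qed
qed

text \<open>A class is the set of all words with the same tree, so its regions together make up
  exactly the points of the cone with distinct coordinates, and these are dense.\<close>

lemma closure_sylvester_class:
  assumes \<pi>: "\<pi> \<in> permutations_of_set UNIV" and x: "x \<in> region \<pi>"
  shows "closure (\<Union>\<sigma>\<in>sylvester_class \<pi>. region \<sigma>) = tree_cone x"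
proof -
  have xd: "distinct_coords x" using region_distinct_coords \<pi> x by blast
  have "(\<Union>\<sigma>\<in>sylvester_class \<pi>. region \<sigma>) = {z \<in> tree_cone x. distinct_coords z}"
  proof (intro subset_antisym subsetI)
    fix z assume "z \<in> (\<Union>\<sigma>\<in>sylvester_class \<pi>. region \<sigma>)"
    then obtain \<sigma> where \<sigma>: "\<sigma> \<in> permutations_of_set UNIV" "equivclp sylvester_step \<pi> \<sigma>" "z \<in> region \<sigma>"
      by (auto simp: sylvester_class_def)
    then have "minimal_pairs x = minimal_pairs z" using sylvester_equiv_minimal_pairs \<pi> x by blast
    then show "z \<in> {z \<in> tree_cone x. distinct_coords z}"
      using region_distinct_coords \<sigma> by (auto simp: tree_cone_iff)
  next
    fix z assume z: "z \<in> {z \<in> tree_cone x. distinct_coords z}"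
    then obtain \<sigma> where \<sigma>: "\<sigma> \<in> permutations_of_set UNIV" "z \<in> region \<sigma>"
      using exists_region by blast
    have "minimal_pairs x = minimal_pairs z" using tree_cone_distinct_eq xd z by blast
    then have "\<sigma> \<in> sylvester_class \<pi>"
      using minimal_pairs_eq_imp_sylvester_equiv[OF \<pi> \<sigma>(1) x \<sigma>(2)] \<sigma>(1)
      by (simp add: sylvester_class_def)
    then show "z \<in> (\<Union>\<sigma>\<in>sylvester_class \<pi>. region \<sigma>)" using \<sigma>(2) by blast
  qed
  moreover have "closure {z \<in> tree_cone x. distinct_coords z} = tree_cone x"
    by (intro subset_antisym tree_cone_closure_distinct[OF xd] closure_minimal closed_tree_cone) auto
  ultimately show ?thesis by simp
qed

lemma sylvester_fan_eq: "sylvester_fan = range tree_cone"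
  unfolding sylvester_fan_def
proof (rule fan_of_tree_cones)
  let ?M = "{closure (\<Union>\<sigma>\<in>sylvester_class \<pi>. region \<sigma>) |\<pi>. \<pi> \<in> permutations_of_set UNIV} :: (real ^ 'a::{finite,linorder}) set set"
  show "?M \<subseteq> range tree_cone"
    using closure_sylvester_class region_nonempty by (smt (verit) mem_Collect_eq rangeI subsetI)
  show "\<Union>?M = UNIV"
  proof (rule UNIV_eq_I[symmetric])
    fix y :: "real ^ 'a::{finite,linorder}"
    obtain x where x: "distinct_coords x" "\<And>p q. y $ p < y $ q \<Longrightarrow> x $ p < x $ q"
      by (rule tie_break) blast
    obtain \<pi> where \<pi>: "\<pi> \<in> permutations_of_set UNIV" "x \<in> region \<pi>"
      using exists_region[OF x(1)] by blast
    have "y \<in> tree_cone x" using tie_break_tree_cone x(2) by blast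
    then show "y \<in> \<Union>?M" using closure_sylvester_class[OF \<pi>] \<pi>(1) by blast
  qed
qed

section \<open>Pulling back a fan along a piecewise linear bijection\<close>

text \<open>The linear pieces are indexed by the cones of the target, and the domain carries no fan
  yet; it receives the preimages. Injectivity of each piece makes it an isomorphism, since both
  spaces coincide.\<close>

locale piecewise_linear_bij =
  fixes f :: "'a::euclidean_space \<Rightarrow> 'a" and G :: "'a set set"
  assumes fan: "complete_fan G"
    and bij: "bij f"
    and lin: "\<And>\<sigma>. \<sigma> \<in> G \<Longrightarrow> \<exists>L. linear L \<and> inj L \<and> (\<forall>x. f x \<in> \<sigma> \<longrightarrow> f x = L x)"
begin

section \<open>Transport of polyhedra, cones and faces\<close>

lemma face_in_fan: "\<sigma> \<in> G \<Longrightarrow> \<tau> face_of \<sigma> \<Longrightarrow> \<tau> \<noteq> {} \<Longrightarrow> \<tau> \<in> G"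
  using fan unfolding complete_fan_def polyhedral_fan_def by blast

lemma Int_face_of:
  "\<sigma> \<in> G \<Longrightarrow> \<tau> \<in> G \<Longrightarrow> \<sigma> \<inter> \<tau> face_of \<sigma>" "\<sigma> \<in> G \<Longrightarrow> \<tau> \<in> G \<Longrightarrow> \<sigma> \<inter> \<tau> face_of \<tau>"
  using fan unfolding complete_fan_def polyhedral_fan_def by blast+

lemma cone_in_fan: "\<sigma> \<in> G \<Longrightarrow> polyhedron \<sigma> \<and> cone \<sigma> \<and> \<sigma> \<noteq> {}"
  using fan unfolding complete_fan_def polyhedral_fan_def by blast

text \<open>If \<open>L x\<close> lies in \<sigma>, surjectivity of \<open>f\<close> gives
  \<open>w\<close> with \<open>f w = L x\<close>; then \<open>L w = L x\<close>, and injectivity of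
  \<open>L\<close> gives \<open>w = x\<close>. So the nonlinear preimage equals a linear
  one.\<close>

lemma obtain_linear:
  assumes "\<sigma> \<in> G"
  obtains L where "linear L" "bij L" "f -` \<sigma> = L -` \<sigma>" "\<And>x. x \<in> f -` \<sigma> \<Longrightarrow> f x = L x"
proof -
  obtain L where L: "linear L" "inj L" "\<And>x. f x \<in> \<sigma> \<Longrightarrow> f x = L x"
    using lin[OF assms] by blast
  then have "bij L" using linear_injective_imp_surjective by (blast intro: bijI)
  moreover have "f -` \<sigma> = L -` \<sigma>"
  proof (intro subset_antisym subsetI)
    fix x assume "x \<in> f -` \<sigma>" then show "x \<in> L -` \<sigma>" using L(3) by force
  next
    fix x assume x: "x \<in> L -` \<sigma>"
    obtain w where w: "f w = L x" using bij by (metis bij_pointE)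
    then have "L w = L x" using x L(3)[of w] by simp
    then have "w = x" using L(2) by (simp add: inj_eq)
    then show "x \<in> f -` \<sigma>" using w x by simp
  qed
  ultimately show thesis using L that by blast
qed

lemma image_vimage: "f ` (f -` S) = S"
  using bij by (simp add: bij_is_surj surj_image_vimage_eq)

lemma vimage_nonempty: "S \<noteq> {} \<Longrightarrow> f -` S \<noteq> {}"
  using image_vimage[of S] by (metis image_empty)

lemma vimage_image: "f -` (f ` S) = S"
  using bij by (simp add: bij_is_inj inj_vimage_image_eq)

text \<open>On subsets of the preimage, \<open>f\<close> agrees with a linear isomorphism, which
  preserves and reflects faces; for any other \<tau> both sides fail.\<close>

lemma face_of_vimage_iff:
  assumes "\<sigma> \<in> G"
  shows "\<tau> face_of f -` \<sigma> \<longleftrightarrow> f ` \<tau> face_of \<sigma>"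
proof (cases "\<tau> \<subseteq> f -` \<sigma>")
  case True
  obtain L where L: "linear L" "bij L" "f -` \<sigma> = L -` \<sigma>" "\<And>x. x \<in> f -` \<sigma> \<Longrightarrow> f x = L x"
    by (rule obtain_linear[OF assms]) blast
  have "L ` (L -` \<sigma>) = \<sigma>" using L(2) by (simp add: bij_is_surj surj_image_vimage_eq)
  moreover have "L ` \<tau> = f ` \<tau>" using True L(4) by (intro image_cong) auto
  ultimately show ?thesis
    using face_of_linear_image[OF L(1) bij_is_inj[OF L(2)], of \<tau> "L -` \<sigma>"] L(3) by simp
next
  case False
  then show ?thesis by (meson face_of_imp_subset image_subset_iff_subset_vimage)
qed

lemma polyhedron_vimage:
  assumes "\<sigma> \<in> G" shows "polyhedron (f -` \<sigma>)"
proof -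
  obtain L where L: "linear L" "bij L" "f -` \<sigma> = L -` \<sigma>"
    by (rule obtain_linear[OF assms]) blast
  have "L ` (f -` \<sigma>) = \<sigma>" using L(2,3) by (simp add: bij_is_surj surj_image_vimage_eq)
  moreover have "polyhedron \<sigma>" using assms cone_in_fan by blast
  ultimately show ?thesis using polyhedron_linear_image_eq[OF L(1,2), of "f -` \<sigma>"] by simp
qed

lemma cone_vimage:
  assumes "\<sigma> \<in> G" shows "cone (f -` \<sigma>)"
proof -
  obtain L where L: "linear L" "f -` \<sigma> = L -` \<sigma>"
    by (rule obtain_linear[OF assms]) blast
  moreover have "cone \<sigma>" using assms cone_in_fan by blast
  ultimately show ?thesis by (auto simp: cone_def linear_cmul)
qed

text \<open>Faces correspond under \<open>f\<close> and preimages commute with intersections, so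
  every fan axiom transfers from \<open>G\<close>.\<close>

lemma complete_fan_vimage: "complete_fan ((\<lambda>\<sigma>. f -` \<sigma>) ` G)"
  unfolding complete_fan_def polyhedral_fan_def
proof (intro conjI ballI allI impI)
  have G: "finite G" "\<Union>G = UNIV" using fan by (auto simp: complete_fan_def polyhedral_fan_def)
  then show "finite ((\<lambda>\<sigma>. f -` \<sigma>) ` G)" by simp
  show "\<Union> ((\<lambda>\<sigma>. f -` \<sigma>) ` G) = UNIV" using G(2) by blast
next
  fix \<sigma> assume "\<sigma> \<in> (\<lambda>\<sigma>. f -` \<sigma>) ` G"
  then obtain \<rho> where \<rho>: "\<rho> \<in> G" "\<sigma> = f -` \<rho>" by blast
  then show "polyhedron \<sigma>" "cone \<sigma>" using polyhedron_vimage cone_vimage by auto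
  have "\<rho> \<noteq> {}" using \<rho> cone_in_fan by blast
  then show "\<sigma> \<noteq> {}" using \<rho> by (simp add: vimage_nonempty)
next
  fix \<sigma> \<tau> assume "\<sigma> \<in> (\<lambda>\<sigma>. f -` \<sigma>) ` G" and \<tau>: "\<tau> face_of \<sigma> \<and> \<tau> \<noteq> {}"
  then obtain \<rho> where \<rho>: "\<rho> \<in> G" "\<sigma> = f -` \<rho>" by blast
  then have "f ` \<tau> face_of \<rho>" "f ` \<tau> \<noteq> {}" using \<tau> face_of_vimage_iff by auto
  then have "f ` \<tau> \<in> G" by (rule face_in_fan[OF \<rho>(1)])
  then show "\<tau> \<in> (\<lambda>\<sigma>. f -` \<sigma>) ` G" using vimage_image[of \<tau>] by (metis imageI)
next
  fix \<sigma> \<tau> assume "\<sigma> \<in> (\<lambda>\<sigma>. f -` \<sigma>) ` G" "\<tau> \<in> (\<lambda>\<sigma>. f -` \<sigma>) ` G"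
  then obtain \<rho> \<rho>' where \<rho>: "\<rho> \<in> G" "\<sigma> = f -` \<rho>" "\<rho>' \<in> G" "\<tau> = f -` \<rho>'" by blast
  then have "\<sigma> \<inter> \<tau> = f -` (\<rho> \<inter> \<rho>')" by auto
  moreover have "\<rho> \<inter> \<rho>' face_of \<rho>" "\<rho> \<inter> \<rho>' face_of \<rho>'"
    using \<rho> by (simp_all add: Int_face_of)
  ultimately show "\<sigma> \<inter> \<tau> face_of \<sigma>" "\<sigma> \<inter> \<tau> face_of \<tau>"
    using \<rho> by (metis face_of_vimage_iff image_vimage)+
qed

lemma fan_of_vimage:
  assumes "M \<subseteq> G"
  shows "fan_of ((\<lambda>\<sigma>. f -` \<sigma>) ` M) = (\<lambda>\<sigma>. f -` \<sigma>) ` fan_of M"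
proof (intro subset_antisym subsetI)
  fix \<tau> assume "\<tau> \<in> fan_of ((\<lambda>\<sigma>. f -` \<sigma>) ` M)"
  then obtain \<sigma> where "\<sigma> \<in> M" "\<tau> \<noteq> {}" "\<tau> face_of f -` \<sigma>" by (auto simp: fan_of_def)
  then have "f ` \<tau> \<in> fan_of M" using assms face_of_vimage_iff by (auto simp: fan_of_def)
  then show "\<tau> \<in> (\<lambda>\<sigma>. f -` \<sigma>) ` fan_of M" using vimage_image[of \<tau>] by (metis imageI)
next
  fix \<tau> assume "\<tau> \<in> (\<lambda>\<sigma>. f -` \<sigma>) ` fan_of M"
  then obtain \<rho> \<sigma> where \<rho>: "\<tau> = f -` \<rho>" "\<sigma> \<in> M" "\<rho> \<noteq> {}" "\<rho> face_of \<sigma>"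
    by (auto simp: fan_of_def)
  then have "\<tau> face_of f -` \<sigma>" "\<tau> \<noteq> {}"
    using assms face_of_vimage_iff[of \<sigma> \<tau>] image_vimage[of \<rho>] vimage_nonempty[of \<rho>] by auto
  then show "\<tau> \<in> fan_of ((\<lambda>\<sigma>. f -` \<sigma>) ` M)" using \<rho> by (auto simp: fan_of_def)
qed

section \<open>The map as a homeomorphism, glued from finitely many closed pieces\<close>

lemma continuous: "continuous_on UNIV f"
proof -
  have "continuous_on (\<Union>\<sigma>\<in>G. f -` \<sigma>) f"
  proof (rule continuous_on_closed_Union)
    show "finite G" using fan by (simp add: complete_fan_def polyhedral_fan_def)
    fix \<sigma> assume \<sigma>: "\<sigma> \<in> G"
    show "closed (f -` \<sigma>)" using polyhedron_vimage[OF \<sigma>] by (rule polyhedron_imp_closed)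
    obtain L where L: "linear L" "\<And>x. x \<in> f -` \<sigma> \<Longrightarrow> f x = L x"
      by (rule obtain_linear[OF \<sigma>]) blast
    have "continuous_on (f -` \<sigma>) L"
      using L(1) by (intro linear_continuous_on) (simp add: linear_conv_bounded_linear)
    then show "continuous_on (f -` \<sigma>) f" by (rule continuous_on_eq) (rule L(2)[symmetric])
  qed
  moreover have "(\<Union>\<sigma>\<in>G. f -` \<sigma>) = UNIV" using fan by (auto simp: complete_fan_def)
  ultimately show ?thesis by simp
qed

lemma continuous_inv: "continuous_on UNIV (inv f)"
proof -
  have "continuous_on (\<Union>\<sigma>\<in>G. \<sigma>) (inv f)"
  proof (rule continuous_on_closed_Union)
    show "finite G" using fan by (simp add: complete_fan_def polyhedral_fan_def)
    fix \<sigma> assume \<sigma>: "\<sigma> \<in> G"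
    then have "polyhedron \<sigma>" using cone_in_fan by blast
    then show "closed \<sigma>" by (rule polyhedron_imp_closed)
    obtain L where L: "linear L" "bij L" "\<And>x. x \<in> f -` \<sigma> \<Longrightarrow> f x = L x"
      by (rule obtain_linear[OF \<sigma>]) blast
    have "inv f y = inv L y" if "y \<in> \<sigma>" for y
    proof -
      have "f (inv f y) = y" using bij by (simp add: bij_is_surj surj_f_inv_f)
      then have "L (inv f y) = y" using L(3)[of "inv f y"] that by simp
      then show ?thesis using L(2) by (metis bij_is_inj inv_f_f)
    qed
    moreover have "linear (inv L)" using L by (simp add: inj_linear_imp_inv_linear bij_is_inj)
    then have "continuous_on \<sigma> (inv L)"
      by (intro linear_continuous_on) (simp add: linear_conv_bounded_linear)
    ultimately show "continuous_on \<sigma> (inv f)" using continuous_on_eq by fastforce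
  qed
  moreover have "(\<Union>\<sigma>\<in>G. \<sigma>) = UNIV" using fan by (auto simp: complete_fan_def)
  ultimately show ?thesis by simp
qed

text \<open>Continuity of \<open>f\<close> gives one inclusion and continuity of
  \<open>inv f\<close> the other. This carries density of points with distinct coordinates back to
  the space of directions.\<close>

lemma closure_vimage: "closure (f -` S) = f -` closure S"
proof (rule closure_unique)
  show "f -` S \<subseteq> f -` closure S" using closure_subset by blast
  show "closed (f -` closure S)" using continuous by (simp add: closed_vimage)
  fix T assume T: "f -` S \<subseteq> T" "closed T"
  have "closed (inv f -` T)" using continuous_inv T(2) by (simp add: closed_vimage)
  moreover have "S \<subseteq> inv f -` T"
    using T(1) bij by (force simp: bij_is_surj surj_f_inv_f)
  ultimately have "closure S \<subseteq> inv f -` T" by (simp add: closure_minimal)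
  then show "f -` closure S \<subseteq> T"
    using bij by (auto dest!: subsetD[of "closure S" "inv f -` T"] simp: bij_is_inj inv_f_f)
qed

lemma pl_fan_isomorphism: "pl_fan_isomorphism f ((\<lambda>\<sigma>. f -` \<sigma>) ` G) G"
  unfolding pl_fan_isomorphism_def
proof (intro conjI)
  show "\<forall>\<sigma>\<in>(\<lambda>\<sigma>. f -` \<sigma>) ` G. \<exists>g. linear g \<and> (\<forall>x\<in>\<sigma>. f x = g x)"
  proof clarify
    fix \<sigma> assume "\<sigma> \<in> G"
    then obtain L where "linear L" "\<And>x. x \<in> f -` \<sigma> \<Longrightarrow> f x = L x"
      by (rule obtain_linear) blast
    then show "\<exists>g. linear g \<and> (\<forall>x\<in>f -` \<sigma>. f x = g x)" by blast
  qed
  show "bij_betw (\<lambda>\<sigma>. f ` \<sigma>) ((\<lambda>\<sigma>. f -` \<sigma>) ` G) G"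
    by (rule bij_betw_byWitness[where f' = "\<lambda>\<sigma>. f -` \<sigma>"]) (use bij_is_surj[OF bij] in auto)
qed (use complete_fan_vimage fan continuous bij in auto)

end

section \<open>The slope map and the pivot fan\<close>

lemma pos_less_iff: "pos i < pos j \<longleftrightarrow> i < j"
proof -
  have *: "pos i < pos j" if "i < j" for i j :: 'a
  proof -
    have "{..i} \<subset> {..j}" using that by auto
    then show ?thesis unfolding pos_def by (simp add: psubset_card_mono)
  qed
  show ?thesis using *[of i j] *[of j i] by (cases i j rule: linorder_cases) auto
qed

lemma pos_eq_iff: "pos i = pos j \<longleftrightarrow> i = j"
  by (metis less_irrefl linorder_neqE pos_less_iff)

lemma pos_le_iff: "pos i \<le> pos j \<longleftrightarrow> i \<le> j"
  by (metis not_le pos_less_iff)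

lemma range_pos: "range (pos :: 'm::{finite,linorder} \<Rightarrow> nat) = {1..CARD('m)}"
proof (rule card_subset_eq)
  show "range (pos :: 'm \<Rightarrow> nat) \<subseteq> {1..CARD('m)}"
    by (auto simp: pos_def Suc_le_eq card_gt_0_iff card_mono)
  have "inj (pos :: 'm \<Rightarrow> nat)" by (simp add: inj_def pos_eq_iff)
  then show "card (range (pos :: 'm \<Rightarrow> nat)) = card {1..CARD('m)}" by (simp add: card_image)
qed simp

lemma pos_bounds: "1 \<le> pos (i :: 'm::{finite,linorder})" "pos i \<le> CARD('m)"
  using range_pos by (metis atLeastAtMost_iff rangeI)+

lemma exists_pos:
  assumes "1 \<le> k" "k \<le> CARD('m)"
  obtains i :: "'m::{finite,linorder}" where "pos i = k"
  using assms range_pos[where 'm = 'm] by (metis atLeastAtMost_iff imageE)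

text \<open>The nearest ancestor of \<open>i\<close> to its right in the Cartesian tree of \<open>x\<close>; \<open>Suc CARD('m)\<close> stands for the top vertex.\<close>

definition next_smaller :: "real ^ 'm::{finite,linorder} \<Rightarrow> 'm \<Rightarrow> nat" where
  "next_smaller x i = (LEAST k. k = Suc CARD('m) \<or> (\<exists>j>i. x $ j < x $ i \<and> k = pos j))"

lemma next_smaller_cases:
  fixes x :: "real ^ 'm::{finite,linorder}"
  shows "next_smaller x i = Suc CARD('m) \<or> (\<exists>j>i. x $ j < x $ i \<and> next_smaller x i = pos j)"
  unfolding next_smaller_def by (rule LeastI_ex) blast

lemma next_smaller_bounds:
  fixes x :: "real ^ 'm::{finite,linorder}"
  shows "pos i < next_smaller x i" "next_smaller x i \<le> Suc CARD('m)"
  using next_smaller_cases[of x i] pos_bounds(2)[where 'm = 'm]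
  by (auto simp: less_Suc_eq_le le_SucI pos_less_iff)

lemma next_smaller_le:
  fixes x :: "real ^ 'm::{finite,linorder}"
  assumes "i < j" "x $ j < x $ i"
  shows "next_smaller x i \<le> pos j"
  unfolding next_smaller_def by (rule Least_le) (use assms in blast)

text \<open>Right ancestors alone determine a tree without ties along it. For \<open>p < q\<close>
  the next smaller index of \<open>p\<close> lies beyond \<open>q\<close>. For \<open>q < p\<close>,
  strictness makes \<open>p\<close> a candidate, so the jump from \<open>q\<close> to its next
  smaller index lowers \<open>x\<close> without passing \<open>p\<close>; iterating reaches
  \<open>p\<close>.\<close>

lemma tree_cone_next_smaller:
  fixes x y :: "real ^ 'm::{finite,linorder}"
  assumes strict: "\<And>p q. (p, q) \<in> minimal_pairs y \<Longrightarrow> p \<noteq> q \<Longrightarrow> y $ p < y $ q"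
    and eq: "next_smaller x = next_smaller y"
  shows "x \<in> tree_cone y"
proof -
  have "x $ p \<le> x $ q" if "(p, q) \<in> minimal_pairs y" for p q
    using that
  \<comment> \<open>The truncated difference is \<open>0\<close> for \<open>p < q\<close>, where the
    induction hypothesis is not invoked.\<close>
  proof (induction "pos p - pos q" arbitrary: q rule: less_induct)
    case less
    show ?case
    proof (cases p q rule: linorder_cases)
      case less': less
      have "\<not> next_smaller y p \<le> pos q"
      proof
        assume le: "next_smaller y p \<le> pos q"
        then have "next_smaller y p \<noteq> Suc CARD('m)" using pos_bounds(2)[of q] by auto
        then obtain j where j: "p < j" "y $ j < y $ p" "next_smaller y p = pos j"
          using next_smaller_cases[of y p] by blast
        then have "j \<le> q" using le pos_le_iff by metis
        then have "y $ p \<le> y $ j" using less.prems j(1) by (auto simp: minimal_pairs_def)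
        then show False using j(2) by simp
      qed
      then show ?thesis using next_smaller_le[of p q x] less' eq by force
    next
      case greater
      have "y $ p < y $ q" using strict less.prems greater by auto
      then have le: "next_smaller y q \<le> pos p" using greater next_smaller_le by blast
      then have "next_smaller x q \<noteq> Suc CARD('m)" using eq pos_bounds(2)[of p] by auto
      then obtain j where j: "q < j" "x $ j < x $ q" "next_smaller x q = pos j"
        using next_smaller_cases[of x q] by blast
      then have jp: "j \<le> p" using le eq pos_le_iff by metis
      then have "(p, j) \<in> minimal_pairs y"
        using minimal_pairs_between[OF less.prems, of j] j(1)
        by (simp add: min_le_iff_disj le_max_iff_disj less_imp_le)
      moreover have "pos p - pos j < pos p - pos q"
        using j(1) jp greater pos_less_iff pos_le_iff by (metis diff_less_mono2)
      ultimately have "x $ p \<le> x $ j" using less.hyps by blast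
      then show ?thesis using j(2) by simp
    qed simp
  qed
  then show ?thesis by (auto simp: tree_cone_def)
qed

text \<open>Heights with prescribed maximal slopes \<open>t\<close> over the abscissae
  \<open>C\<close> are chosen from the last index downwards; the conditions at \<open>k\<close>
  involve only indices from \<open>k\<close> on, so later choices do not disturb them.\<close>

lemma exists_heights:
  fixes C t :: "nat \<Rightarrow> real" and n :: nat
  shows "\<exists>h. \<forall>k<n. (\<forall>j\<in>{k<..n}. h j - h k \<le> t k * (C j - C k)) \<and>
                   (\<exists>j\<in>{k<..n}. h j - h k = t k * (C j - C k))"
proof -
  let ?P = "\<lambda>h k. (\<forall>j\<in>{k<..n}. h j - h k \<le> t k * (C j - C k)) \<and>
                   (\<exists>j\<in>{k<..n}. h j - h k = t k * (C j - C k))"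
  have "\<exists>h. \<forall>k. n - d \<le> k \<and> k < n \<longrightarrow> ?P h k" for d
  proof (induction d)
    case 0 then show ?case by auto
  next
    case (Suc d)
    then obtain h where h: "\<And>k. n - d \<le> k \<Longrightarrow> k < n \<Longrightarrow> ?P h k" by blast
    show ?case
    proof (cases "n - d = 0")
      case True
      then show ?thesis using h by auto
    next
      case False
      define l where "l = n - Suc d"
      \<comment> \<open>The least height at \<open>l\<close> satisfying all inequalities at
        \<open>l\<close>; being a maximum, it makes one of them an equality.\<close>
      define M where "M = Max ((\<lambda>j. h j - t l * (C j - C l)) ` {l<..n})"
      define h' where "h' = h(l := M)"
      have ne: "{l<..n} \<noteq> {}" using False by (auto simp: l_def)
      have "?P h' k" if k: "n - Suc d \<le> k" "k < n" for k
      proof (cases "k = l")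
        case True
        have "M \<in> (\<lambda>j. h j - t l * (C j - C l)) ` {l<..n}"
          unfolding M_def using ne by (intro Max_in) auto
        then obtain j where j: "j \<in> {l<..n}" "M = h j - t l * (C j - C l)" by blast
        have "h j - t l * (C j - C l) \<le> M" if "j \<in> {l<..n}" for j
          unfolding M_def using that by (intro Max_ge) auto
        then have "\<forall>j\<in>{l<..n}. h' j - h' l \<le> t l * (C j - C l)"
          by (auto simp: h'_def algebra_simps)
        moreover have "h' j - h' l = t l * (C j - C l)" using j by (auto simp: h'_def)
        ultimately show ?thesis using True j(1) by blast
      next
        case False
        then have "n - d \<le> k" using k by (auto simp: l_def)
        moreover have "\<And>j. j \<ge> k \<Longrightarrow> h' j = h j"
          using False k by (auto simp: h'_def l_def)
        ultimately show ?thesis using h[of k] k(2) by auto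
      qed
      then show ?thesis by blast
    qed
  qed
  from this[of n] show ?thesis by auto
qed

locale generic_simplex =
  fixes \<Delta> :: "(real ^ 'm::{finite,linorder}) set"
    and c :: "real ^ 'm::{finite,linorder}"
    and u :: "nat \<Rightarrow> real ^ 'm::{finite,linorder}"
  assumes dim: "CARD('m) \<ge> 2"
    and simplex: "(int CARD('m)) simplex \<Delta>"
    and labels: "bij_betw u {1..Suc CARD('m)} (vertices \<Delta>)"
    and increasing: "\<forall>i\<in>{1..Suc CARD('m)}. \<forall>j\<in>{1..Suc CARD('m)}. i < j \<longrightarrow> c \<bullet> u i < c \<bullet> u j"
begin

abbreviation \<theta> :: "real ^ 'm::{finite,linorder} \<Rightarrow> real ^ 'm::{finite,linorder}" where
  "\<theta> \<equiv> slope_map \<Delta> c u"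

section \<open>Vertices and their heights\<close>

lemma vertices_eq: "vertices \<Delta> = u ` {1..Suc CARD('m)}"
  using labels by (simp add: bij_betw_def)

lemma c_less: "1 \<le> i \<Longrightarrow> i < j \<Longrightarrow> j \<le> Suc CARD('m) \<Longrightarrow> c \<bullet> u i < c \<bullet> u j"
  using increasing by auto

lemma c_less_iff: "i \<in> {1..Suc CARD('m)} \<Longrightarrow> j \<in> {1..Suc CARD('m)} \<Longrightarrow> c \<bullet> u i < c \<bullet> u j \<longleftrightarrow> i < j"
  using increasing by (metis less_asym less_irrefl linorder_neqE_nat)

lemma c_less_pos: "pos (i :: 'm) < k \<Longrightarrow> k \<le> Suc CARD('m) \<Longrightarrow> c \<bullet> u (pos i) < c \<bullet> u k"
  using c_less pos_bounds(1) by blast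

lemma u_eq_iff: "i \<in> {1..Suc CARD('m)} \<Longrightarrow> j \<in> {1..Suc CARD('m)} \<Longrightarrow> u i = u j \<longleftrightarrow> i = j"
  using labels by (meson bij_betw_def inj_on_eq_iff)

text \<open>The vertices are affinely independent and one more in number than the dimension, so the
  edges at the top vertex form a basis.\<close>

lemma orthogonal_edges_imp_zero:
  assumes "\<And>i :: 'm. \<omega> \<bullet> u (pos i) = \<omega> \<bullet> u (Suc CARD('m))"
  shows "\<omega> = 0"
proof -
  let ?n = "Suc CARD('m)"
  obtain V where V: "\<not> affine_dependent V" "int (card V) = int CARD('m) + 1" "\<Delta> = convex hull V"
    using simplex by (auto simp: simplex_def)
  have "V = vertices \<Delta>"
    using V(1,3) by (auto simp: vertices_def extreme_point_of_convex_hull_affine_independent)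
  then have V_eq: "V = insert (u ?n) (u ` {1..CARD('m)})"
    unfolding vertices_eq by (simp add: atLeastAtMostSuc_conv)
  let ?B = "(\<lambda>x. - u ?n + x) ` u ` {1..CARD('m)}"
  have "u ?n \<notin> u ` {1..CARD('m)}" 
  proof
    assume "u ?n \<in> u ` {1..CARD('m)}"
    then obtain k where "k \<in> {1..CARD('m)}" "u ?n = u k" by blast
    then show False using u_eq_iff[of ?n k] by simp
  qed
  then have ind: "independent ?B"
    using V(1) by (simp only: V_eq affine_dependent_iff_dependent simp_thms)
  have inj: "inj_on u {1..CARD('m)}" using labels by (auto simp: bij_betw_def intro: inj_on_subset)
  have "card ?B = card (u ` {1..CARD('m)})" by (rule card_image) simp
  also have "\<dots> = CARD('m)" using card_image[OF inj] by simp
  finally have card: "card ?B = CARD('m)" .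
  have "(UNIV :: (real ^ 'm::{finite,linorder}) set) \<subseteq> span ?B"
    by (rule card_ge_dim_independent) (use ind card in auto)
  then have "\<omega> \<in> span ?B" by blast
  moreover have "\<omega> \<bullet> x = 0" if x: "x \<in> ?B" for x
  proof -
    obtain k where k: "1 \<le> k" "k \<le> CARD('m)" "x = - u ?n + u k" using x by auto
    obtain i :: 'm where "pos i = k" using exists_pos k by blast
    then show ?thesis using assms[of i] k(3) by (simp add: inner_diff_right)
  qed
  ultimately have "orthogonal \<omega> \<omega>"
    by (intro orthogonal_to_span[of \<omega> ?B \<omega>]) (simp_all add: orthogonal_def)
  then show ?thesis by (simp add: orthogonal_def)
qed

text \<open>Height differences to the top vertex are injective linear functions of \<omega> between
  spaces of equal dimension, hence arbitrary. The common shift \<open>b\<close> is invisible to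
  slopes.\<close>

lemma exists_with_heights:
  obtains \<omega> :: "real ^ 'm::{finite,linorder}" and b where "\<And>k. 1 \<le> k \<Longrightarrow> k \<le> Suc CARD('m) \<Longrightarrow> \<omega> \<bullet> u k = h k + b"
proof -
  let ?E = "\<lambda>\<omega> :: real ^ 'm::{finite,linorder}. \<chi> i :: 'm. \<omega> \<bullet> (u (pos i) - u (Suc CARD('m)))"
  have lin: "linear ?E" by (rule linearI) (auto simp: vec_eq_iff inner_left_distrib)
  moreover have "inj ?E"
    unfolding linear_injective_0[OF lin]
  proof (intro allI impI)
    fix \<omega> :: "real ^ 'm::{finite,linorder}"
    assume zero: "?E \<omega> = 0"
    have "?E \<omega> $ i = 0" for i using arg_cong[OF zero, of "\<lambda>v. v $ i"] by simp
    then have "\<omega> \<bullet> u (pos i) = \<omega> \<bullet> u (Suc CARD('m))" for i :: 'm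
      by (simp add: inner_diff_right)
    then show "\<omega> = 0" by (rule orthogonal_edges_imp_zero)
  qed
  ultimately have "surj ?E" using linear_injective_imp_surjective by blast
  then obtain \<omega> where E: "(\<chi> i. h (pos i) - h (Suc CARD('m))) = ?E \<omega>" by (rule surjE)
  have \<omega>: "\<omega> \<bullet> u (pos i) = h (pos i) - h (Suc CARD('m)) + \<omega> \<bullet> u (Suc CARD('m))" for i :: 'm
    using arg_cong[OF E, of "\<lambda>v. v $ i"] by (simp add: inner_diff_right)
  have "\<omega> \<bullet> u k = h k + (\<omega> \<bullet> u (Suc CARD('m)) - h (Suc CARD('m)))" if "1 \<le> k" "k \<le> Suc CARD('m)" for k
  proof (cases "k = Suc CARD('m)")
    case False
    then have "1 \<le> k" "k \<le> CARD('m)" using that by auto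
    then obtain i :: 'm where "pos i = k" by (rule exists_pos)
    then show ?thesis using \<omega>[of i] by simp
  qed simp
  then show thesis by (rule that)
qed

section \<open>Slopes and steepest improving neighbors\<close>

lemma improving_neighbors_eq:
  assumes "1 \<le> k" "k \<le> Suc CARD('m)"
  shows "improving_neighbors \<Delta> c (u k) = u ` {k<..Suc CARD('m)}"
  unfolding improving_neighbors_def vertices_eq
  using assms by (auto simp: c_less_iff)

lemma max_slope_eq: "max_slope \<Delta> c \<omega> (u (pos (i :: 'm))) = ereal (\<theta> \<omega> $ i)"
  and theta_eq_Max: "\<theta> \<omega> $ i =
    Max ((\<lambda>k. (\<omega> \<bullet> u k - \<omega> \<bullet> u (pos i)) / (c \<bullet> u k - c \<bullet> u (pos i))) ` {pos i<..Suc CARD('m)})"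
proof -
  have "improving_neighbors \<Delta> c (u (pos i)) = u ` {pos i<..Suc CARD('m)}"
    using pos_bounds[of i] by (intro improving_neighbors_eq) auto
  moreover have "{pos i<..Suc CARD('m)} \<noteq> {}" using pos_bounds(2)[of i] by auto
  ultimately have "max_slope \<Delta> c \<omega> (u (pos i)) =
    ereal (Max ((\<lambda>k. (\<omega> \<bullet> u k - \<omega> \<bullet> u (pos i)) / (c \<bullet> u k - c \<bullet> u (pos i))) ` {pos i<..Suc CARD('m)}))"
    by (simp add: max_slope_def slope_def image_image inner_diff_right)
  then show "max_slope \<Delta> c \<omega> (u (pos i)) = ereal (\<theta> \<omega> $ i)" "\<theta> \<omega> $ i =
    Max ((\<lambda>k. (\<omega> \<bullet> u k - \<omega> \<bullet> u (pos i)) / (c \<bullet> u k - c \<bullet> u (pos i))) ` {pos i<..Suc CARD('m)})"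
    by (simp_all add: slope_map_def)
qed

text \<open>Attainment of the maximal slope, written with cleared denominators and vertex labels. It
  is a relation because several neighbors may attain the maximum.\<close>

definition steepest :: "real ^ 'm::{finite,linorder} \<Rightarrow> 'm \<Rightarrow> nat \<Rightarrow> bool" where
  "steepest \<omega> i k \<longleftrightarrow> pos i < k \<and> k \<le> Suc CARD('m) \<and>
     \<omega> \<bullet> u k - \<omega> \<bullet> u (pos i) = \<theta> \<omega> $ i * (c \<bullet> u k - c \<bullet> u (pos i))"

lemma theta_ge:
  assumes "pos i < k" "k \<le> Suc CARD('m)"
  shows "\<omega> \<bullet> u k - \<omega> \<bullet> u (pos i) \<le> \<theta> \<omega> $ i * (c \<bullet> u k - c \<bullet> u (pos i))"
proof -
  have "(\<omega> \<bullet> u k - \<omega> \<bullet> u (pos i)) / (c \<bullet> u k - c \<bullet> u (pos i)) \<le> \<theta> \<omega> $ i"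
    unfolding theta_eq_Max using assms by (intro Max_ge) auto
  then show ?thesis using c_less_pos[OF assms] by (simp add: divide_le_eq)
qed

lemma steepest_exists: obtains k where "steepest \<omega> i k"
proof -
  have "\<theta> \<omega> $ i \<in> (\<lambda>k. (\<omega> \<bullet> u k - \<omega> \<bullet> u (pos i)) / (c \<bullet> u k - c \<bullet> u (pos i))) ` {pos i<..Suc CARD('m)}"
    unfolding theta_eq_Max using pos_bounds(2)[of i] by (intro Max_in) auto
  then obtain k where k: "pos i < k" "k \<le> Suc CARD('m)"
    "\<theta> \<omega> $ i = (\<omega> \<bullet> u k - \<omega> \<bullet> u (pos i)) / (c \<bullet> u k - c \<bullet> u (pos i))" by auto
  then have "steepest \<omega> i k" using c_less_pos[OF k(1,2)] by (simp add: steepest_def)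
  then show thesis by (rule that)
qed

lemma theta_eqI:
  assumes "\<And>k. pos i < k \<Longrightarrow> k \<le> Suc CARD('m) \<Longrightarrow> \<omega> \<bullet> u k - \<omega> \<bullet> u (pos i) \<le> t * (c \<bullet> u k - c \<bullet> u (pos i))"
    and "pos i < l" "l \<le> Suc CARD('m)" "\<omega> \<bullet> u l - \<omega> \<bullet> u (pos i) = t * (c \<bullet> u l - c \<bullet> u (pos i))"
  shows "\<theta> \<omega> $ i = t"
proof (rule antisym)
  obtain k where k: "steepest \<omega> i k" by (rule steepest_exists)
  then have "\<theta> \<omega> $ i * (c \<bullet> u k - c \<bullet> u (pos i)) \<le> t * (c \<bullet> u k - c \<bullet> u (pos i))"
    using assms(1)[of k] by (simp add: steepest_def)
  then show "\<theta> \<omega> $ i \<le> t" using k c_less_pos[of i k] by (simp add: steepest_def)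
  have "t * (c \<bullet> u l - c \<bullet> u (pos i)) \<le> \<theta> \<omega> $ i * (c \<bullet> u l - c \<bullet> u (pos i))"
    using theta_ge[OF assms(2,3), of \<omega>] assms(4) by simp
  then show "t \<le> \<theta> \<omega> $ i" using c_less_pos[OF assms(2,3)] by simp
qed

text \<open>
  Subtracting \<open>\<theta> \<omega> $ i * (c \<bullet> _)\<close> from the heights turns slopes larger than \<open>\<theta> \<omega> $ i\<close> into ascents;
  the last maximiser of the sheared heights cannot lie before \<open>a\<close>, and beyond \<open>a\<close> nothing ascends.
\<close>

lemma steepest_if_next:
  assumes a: "pos i < a" "a \<le> Suc CARD('m)"
    and between: "\<And>j. i < j \<Longrightarrow> pos j < a \<Longrightarrow> \<theta> \<omega> $ i \<le> \<theta> \<omega> $ j"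
    and at: "a = Suc CARD('m) \<or> (\<exists>j. a = pos j \<and> \<theta> \<omega> $ j \<le> \<theta> \<omega> $ i)"
  shows "steepest \<omega> i a"
proof -
  define t where "t = \<theta> \<omega> $ i"
  define \<phi> where "\<phi> k = \<omega> \<bullet> u k - t * (c \<bullet> u k)" for k
  have st: "steepest \<omega> i k \<longleftrightarrow> pos i < k \<and> k \<le> Suc CARD('m) \<and> \<phi> k = \<phi> (pos i)" for k
    by (auto simp: steepest_def \<phi>_def t_def algebra_simps)
  have le: "\<phi> k \<le> \<phi> (pos i)" if "pos i < k" "k \<le> Suc CARD('m)" for k
    using theta_ge[OF that, of \<omega>] by (simp add: \<phi>_def t_def algebra_simps)
  define f where "f = Max {k. steepest \<omega> i k}"
  have fin: "finite {k. steepest \<omega> i k}"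
    by (rule finite_subset[of _ "{..Suc CARD('m)}"]) (auto simp: steepest_def)
  have "{k. steepest \<omega> i k} \<noteq> {}" using steepest_exists by blast
  then have f: "steepest \<omega> i f" using fin Max_in unfolding f_def by blast
  have max: "k \<le> f" if "steepest \<omega> i k" for k using that fin by (simp add: f_def)
  show ?thesis
  proof (cases f a rule: linorder_cases)
    \<comment> \<open>The vertex labelled \<open>f\<close> has maximal slope at least
      \<open>t\<close>, so following its steepest edge produces a maximiser later than
      \<open>f\<close>, contradicting the choice of \<open>f\<close>.\<close>
    case less
    then have "1 \<le> f" "f \<le> CARD('m)" using f a by (auto simp: steepest_def)
    then obtain j :: 'm where j: "pos j = f" by (rule exists_pos)
    then have ij: "i < j" using f pos_less_iff by (auto simp: steepest_def)
    then have tj: "t \<le> \<theta> \<omega> $ j" using between less j by (auto simp: t_def)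
    obtain g where g: "steepest \<omega> j g" by (rule steepest_exists)
    then have g': "f < g" "g \<le> Suc CARD('m)" using j by (auto simp: steepest_def)
    have "t * (c \<bullet> u g - c \<bullet> u f) \<le> \<theta> \<omega> $ j * (c \<bullet> u g - c \<bullet> u f)"
      using tj c_less_pos[of j g] g' j by (intro mult_right_mono) auto
    then have "\<phi> f \<le> \<phi> g" using g j by (simp add: steepest_def \<phi>_def algebra_simps)
    moreover have "\<phi> g \<le> \<phi> (pos i)" using le g' f by (simp add: steepest_def)
    moreover have "\<phi> f = \<phi> (pos i)" using f by (simp add: st)
    ultimately have "steepest \<omega> i g" using g' f by (auto simp: st)
    then show ?thesis using max g' by fastforce
  next
    case equal then show ?thesis using f by simp
  next
    \<comment> \<open>Here \<open>a\<close> is not the top label. The maximal slope at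
      \<open>a\<close> is at most \<open>t\<close>, so the sheared height does not rise from
      \<open>a\<close> to \<open>f\<close>, and \<open>a\<close> is a maximiser as well.\<close>
    case greater
    have ft: "f \<le> Suc CARD('m)" using f by (simp add: steepest_def)
    then obtain j where j: "a = pos j" "\<theta> \<omega> $ j \<le> t" using at greater by (auto simp: t_def)
    have "\<omega> \<bullet> u f - \<omega> \<bullet> u a \<le> \<theta> \<omega> $ j * (c \<bullet> u f - c \<bullet> u a)"
      using theta_ge[of j f \<omega>] greater ft j by simp
    also have "\<dots> \<le> t * (c \<bullet> u f - c \<bullet> u a)"
      using j c_less_pos[of j f] greater ft by (intro mult_right_mono) auto
    finally have "\<phi> f \<le> \<phi> a" by (simp add: \<phi>_def algebra_simps)
    moreover have "\<phi> a \<le> \<phi> (pos i)" using le a by simp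
    ultimately show ?thesis using f a by (auto simp: st)
  qed
qed

text \<open>Up to its next smaller index, \<open>i\<close> is minimal for \<open>x\<close>; that
  index, unless it is the top label, is minimal back to \<open>i\<close>. The cone hypothesis
  carries both relations over to \<open>\<theta> \<omega>\<close>, ties included.\<close>

lemma steepest_next_smaller:
  assumes "\<theta> \<omega> \<in> tree_cone x"
  shows "steepest \<omega> i (next_smaller x i)"
proof (rule steepest_if_next)
  show "pos i < next_smaller x i" "next_smaller x i \<le> Suc CARD('m)"
    by (rule next_smaller_bounds)+
  have below: "x $ i \<le> x $ k" if "i \<le> k" "pos k < next_smaller x i" for k
    using that next_smaller_le[of i k x] by (cases "k = i") force+
  show "\<theta> \<omega> $ i \<le> \<theta> \<omega> $ j" if j: "i < j" "pos j < next_smaller x i" for j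
  proof (rule tree_coneD[OF assms])
    have "x $ i \<le> x $ k" if "k \<in> {i..j}" for k
    proof (rule below)
      show "pos k < next_smaller x i" using that j(2) pos_le_iff[of k j] by simp
    qed (use that in simp)
    then show "(i, j) \<in> minimal_pairs x" using j by (simp add: minimal_pairs_def)
  qed
  show "next_smaller x i = Suc CARD('m) \<or> (\<exists>j. next_smaller x i = pos j \<and> \<theta> \<omega> $ j \<le> \<theta> \<omega> $ i)"
  proof (cases "next_smaller x i = Suc CARD('m)")
    case False
    then obtain j where j: "i < j" "x $ j < x $ i" "next_smaller x i = pos j"
      using next_smaller_cases[of x i] by blast
    have "x $ j \<le> x $ k" if "k \<in> {i..j}" for k
    proof (cases "k = j")
      case False
      then have "x $ i \<le> x $ k" using that j(3) pos_less_iff[of k j] by (intro below) auto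
      then show ?thesis using j(2) by simp
    qed simp
    then have "(j, i) \<in> minimal_pairs x" using j(1) by (simp add: minimal_pairs_def)
    then show ?thesis using j(3) tree_coneD[OF assms] by blast
  qed simp
qed

text \<open>Fixing \<open>x\<close> fixes the tree edges, so this is linear in \<omega>; it extends
  to the whole space the restriction of \<theta> to the preimage of
  \<open>tree_cone x\<close>.\<close>

definition linear_branch :: "real ^ 'm::{finite,linorder} \<Rightarrow> real ^ 'm::{finite,linorder} \<Rightarrow> real ^ 'm::{finite,linorder}" where
  "linear_branch x \<omega> = (\<chi> i. (\<omega> \<bullet> (u (next_smaller x i) - u (pos i))) /
                             (c \<bullet> (u (next_smaller x i) - u (pos i))))"

lemma theta_eq_linear_branch:
  assumes "\<theta> \<omega> \<in> tree_cone x"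
  shows "\<theta> \<omega> = linear_branch x \<omega>"
proof (simp add: vec_eq_iff linear_branch_def, rule allI)
  fix i
  have "steepest \<omega> i (next_smaller x i)" using assms by (rule steepest_next_smaller)
  then show "\<theta> \<omega> $ i = (\<omega> \<bullet> (u (next_smaller x i) - u (pos i))) / (c \<bullet> (u (next_smaller x i) - u (pos i)))"
    using c_less_pos[of i "next_smaller x i"]
    by (simp add: steepest_def inner_diff_right eq_divide_eq)
qed

lemma linear_linear_branch: "linear (linear_branch x)"
  by (rule linearI) (simp_all add: linear_branch_def vec_eq_iff inner_left_distrib add_divide_distrib)

text \<open>For \<omega> in the kernel, heights are constant along every edge to the next smaller
  index. Such edges increase the label and end at the top vertex, so all heights agree.\<close>

lemma inj_linear_branch: "inj (linear_branch x)"
  unfolding linear_injective_0[OF linear_linear_branch]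
proof (intro allI impI)
  fix \<omega> assume zero: "linear_branch x \<omega> = 0"
  have step: "\<omega> \<bullet> u (pos i) = \<omega> \<bullet> u (next_smaller x i)" for i
  proof -
    have "linear_branch x \<omega> $ i = 0" using zero by simp
    then show ?thesis
      using c_less_pos[of i "next_smaller x i"] next_smaller_bounds[where i = i and x = x]
      by (simp add: linear_branch_def inner_diff_right)
  qed
  have "\<omega> \<bullet> u (pos i) = \<omega> \<bullet> u (Suc CARD('m))" for i :: 'm
  proof (induction "(Suc CARD('m)) - pos i" arbitrary: i rule: less_induct)
    case less
    show ?case
    proof (cases "next_smaller x i = Suc CARD('m)")
      case False
      then obtain j where j: "i < j" "next_smaller x i = pos j"
        using next_smaller_cases[of x i] by blast
      then have "(Suc CARD('m)) - pos j < (Suc CARD('m)) - pos i"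
        using pos_less_iff[of i j] pos_bounds(2)[of j] by simp
      then show ?thesis using less[of j] step[of i] j(2) by simp
    qed (use step[of i] in simp)
  qed
  then show "\<omega> = 0" by (rule orthogonal_edges_imp_zero)
qed

text \<open>Two directions with the same image are seen by the same linear branch, that of the
  common image.\<close>

lemma inj_theta: "inj \<theta>"
proof (rule injI)
  fix \<omega> \<omega>' assume eq: "\<theta> \<omega> = \<theta> \<omega>'"
  then have "linear_branch (\<theta> \<omega>) \<omega> = linear_branch (\<theta> \<omega>) \<omega>'"
    using theta_eq_linear_branch tree_cone_self by metis
  then show "\<omega> = \<omega>'" using inj_linear_branch by (simp add: inj_eq)
qed

lemma surj_theta: "surj \<theta>"
proof (rule surjI)
  fix y :: "real ^ 'm::{finite,linorder}"
  \<comment> \<open>At \<open>k = 0\<close>, which labels no vertex, \<open>inv pos k\<close> is an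
    unspecified index; only the instances \<open>k = pos i\<close> are evaluated.\<close>
  obtain h where h: "\<And>k. k < (Suc CARD('m)) \<Longrightarrow>
      (\<forall>j\<in>{k<..Suc CARD('m)}. h j - h k \<le> y $ (inv pos k) * (c \<bullet> u j - c \<bullet> u k)) \<and>
      (\<exists>j\<in>{k<..Suc CARD('m)}. h j - h k = y $ (inv pos k) * (c \<bullet> u j - c \<bullet> u k))"
    using exists_heights[of "Suc CARD('m)" "\<lambda>k. y $ (inv pos k)" "\<lambda>k. c \<bullet> u k"] by blast
  obtain \<omega> b where \<omega>: "\<And>k. 1 \<le> k \<Longrightarrow> k \<le> Suc CARD('m) \<Longrightarrow> \<omega> \<bullet> u k = h k + b"
    using exists_with_heights[of h] by blast
  have "\<theta> \<omega> $ i = y $ i" for i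
  proof -
    have i: "inv pos (pos i) = i" by (simp add: inv_f_f inj_def pos_eq_iff)
    have hi: "\<forall>j\<in>{pos i<..Suc CARD('m)}. h j - h (pos i) \<le> y $ i * (c \<bullet> u j - c \<bullet> u (pos i))"
      "\<exists>j\<in>{pos i<..Suc CARD('m)}. h j - h (pos i) = y $ i * (c \<bullet> u j - c \<bullet> u (pos i))"
      using h[of "pos i"] pos_bounds(2)[of i] i by auto
    then obtain l where l: "pos i < l" "l \<le> Suc CARD('m)" "h l - h (pos i) = y $ i * (c \<bullet> u l - c \<bullet> u (pos i))"
      by auto
    have d: "\<omega> \<bullet> u k - \<omega> \<bullet> u (pos i) = h k - h (pos i)" if "pos i < k" "k \<le> Suc CARD('m)" for k
      using \<omega>[of k] \<omega>[of "pos i"] pos_bounds[of i] that by simp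
    show ?thesis
      by (rule theta_eqI[of i _ _ l]) (use hi l d in auto)
  qed
  then have "\<theta> \<omega> = y" by (simp add: vec_eq_iff)
  then show "\<theta> (inv \<theta> y) = y" by (metis f_inv_into_f rangeI)
qed

sublocale piecewise_linear_bij \<theta> "range tree_cone"
proof
  show "complete_fan (range (tree_cone :: real ^ 'm::{finite,linorder} \<Rightarrow> _))" by (rule complete_fan_tree_cones)
  show "bij \<theta>" using inj_theta surj_theta by (rule bijI)
  fix \<sigma> :: "(real ^ 'm::{finite,linorder}) set" assume "\<sigma> \<in> range tree_cone"
  then obtain x where "\<sigma> = tree_cone x" by blast
  then show "\<exists>L. linear L \<and> inj L \<and> (\<forall>\<omega>. \<theta> \<omega> \<in> \<sigma> \<longrightarrow> \<theta> \<omega> = L \<omega>)"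
    using linear_linear_branch inj_linear_branch theta_eq_linear_branch by blast
qed

section \<open>Generic directions, arborescences and the pivot fan\<close>

lemma slope_eq_max_slope_iff:
  assumes "pos i < k" "k \<le> Suc CARD('m)"
  shows "ereal (slope c \<omega> (u (pos i)) (u k)) = max_slope \<Delta> c \<omega> (u (pos i)) \<longleftrightarrow> steepest \<omega> i k"
  using assms c_less_pos[OF assms]
  by (simp add: max_slope_eq slope_def steepest_def inner_diff_right divide_eq_eq)

lemma steepest_vertex_iff:
  "v \<in> improving_neighbors \<Delta> c (u (pos i)) \<and>
     ereal (slope c \<omega> (u (pos i)) v) = max_slope \<Delta> c \<omega> (u (pos i)) \<longleftrightarrow>
   (\<exists>k. steepest \<omega> i k \<and> v = u k)"
proof -
  have "improving_neighbors \<Delta> c (u (pos i)) = u ` {pos i<..Suc CARD('m)}"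
    using pos_bounds[of i] by (intro improving_neighbors_eq) auto
  then show ?thesis using slope_eq_max_slope_iff by (auto simp: steepest_def)
qed

lemma improving_neighbors_pos_nonempty: "improving_neighbors \<Delta> c (u (pos (i :: 'm))) \<noteq> {}"
  using pos_bounds[of i] improving_neighbors_eq[of "pos i"] by auto

lemma improving_neighbors_top: "improving_neighbors \<Delta> c (u (Suc CARD('m))) = {}"
  using improving_neighbors_eq[of "Suc CARD('m)"] by auto

lemma all_vertices_iff:
  "(\<forall>v\<in>vertices \<Delta>. P v) \<longleftrightarrow> (\<forall>i :: 'm. P (u (pos i))) \<and> P (u (Suc CARD('m)))"
proof -
  have "{1..Suc CARD('m)} = insert (Suc CARD('m)) (range (pos :: 'm \<Rightarrow> nat))"
    by (simp add: range_pos atLeastAtMostSuc_conv)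
  then show ?thesis unfolding vertices_eq by auto
qed

lemma steepest_index: "steepest \<omega> i k \<Longrightarrow> k \<in> {1..Suc CARD('m)}"
  by (auto simp: steepest_def)

lemma generic_direction_iff:
  "generic_direction \<Delta> c \<omega> \<longleftrightarrow> \<omega> \<notin> span {c} \<and> (\<forall>i k l. steepest \<omega> i k \<longrightarrow> steepest \<omega> i l \<longrightarrow> k = l)"
proof -
  have "(\<exists>!v. \<exists>k. steepest \<omega> i k \<and> v = u k) \<longleftrightarrow> (\<forall>k l. steepest \<omega> i k \<longrightarrow> steepest \<omega> i l \<longrightarrow> k = l)"
    for i
    using steepest_exists[of \<omega> i] steepest_index u_eq_iff by (metis (no_types, lifting))
  then show ?thesis
    unfolding generic_direction_def all_vertices_iff
    by (simp add: steepest_vertex_iff improving_neighbors_pos_nonempty improving_neighbors_top)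
qed

lemma arborescence_eq:
  assumes "generic_direction \<Delta> c \<omega>" "steepest \<omega> i k"
  shows "arborescence \<Delta> c \<omega> (u (pos i)) = u k"
proof -
  have "(THE v. \<exists>k. steepest \<omega> i k \<and> v = u k) = u k"
    using assms by (intro the_equality) (auto simp: generic_direction_iff)
  then show ?thesis
    by (simp add: arborescence_def steepest_vertex_iff improving_neighbors_pos_nonempty)
qed

text \<open>A multiple of \<open>c\<close> has all slopes equal, which is impossible in dimension at
  least \<open>2\<close>. Two steepest neighbors of one vertex would give the earlier of them the
  same maximal slope as that vertex.\<close>

lemma distinct_imp_generic:
  assumes d: "distinct_coords (\<theta> \<omega>)"
  shows "generic_direction \<Delta> c \<omega>"
  unfolding generic_direction_iff
proof (intro conjI allI impI notI)
  assume "\<omega> \<in> span {c}"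
  then obtain r where r: "\<omega> = r *\<^sub>R c" by (auto simp: span_singleton)
  have "\<theta> \<omega> $ i = r" for i :: 'm
    by (rule theta_eqI[where l = "Suc CARD('m)"])
       (use pos_bounds(2)[of i] in \<open>auto simp: r algebra_simps\<close>)
  then have "\<And>i j :: 'm. i = j" using d by (metis injD)
  then have "CARD('m) \<le> 1" by (simp add: card_le_Suc0_iff_eq)
  then show False using dim by simp
next
  have wlog: False if kl: "steepest \<omega> i k" "steepest \<omega> i l" "k < l" for i k l
  proof -
    have k: "pos i < k" "k \<le> Suc CARD('m)" "l \<le> Suc CARD('m)" using kl by (auto simp: steepest_def)
    then have "1 \<le> k" "k \<le> CARD('m)" using kl(3) by auto
    then obtain j :: 'm where j: "pos j = k" by (rule exists_pos)
    let ?t = "\<theta> \<omega> $ i"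
    \<comment> \<open>Heights of \<open>i\<close>, \<open>k\<close> and \<open>l\<close> lie on one
      line of slope \<open>?t\<close> over \<open>c\<close>, and no later vertex rises above
      it.\<close>
    have "\<theta> \<omega> $ j = ?t"
    proof (rule theta_eqI[where l = l])
      fix n assume n: "pos j < n" "n \<le> Suc CARD('m)"
      have "\<omega> \<bullet> u n - \<omega> \<bullet> u (pos i) \<le> ?t * (c \<bullet> u n - c \<bullet> u (pos i))"
        using n k j by (intro theta_ge) auto
      then show "\<omega> \<bullet> u n - \<omega> \<bullet> u (pos j) \<le> ?t * (c \<bullet> u n - c \<bullet> u (pos j))"
        using kl(1) j by (simp add: steepest_def algebra_simps)
    next
      show "\<omega> \<bullet> u l - \<omega> \<bullet> u (pos j) = ?t * (c \<bullet> u l - c \<bullet> u (pos j))"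
        using kl(1,2) j by (simp add: steepest_def algebra_simps)
    qed (use kl j k in auto)
    then have "i = j" using d by (metis injD)
    then show False using k(1) j by simp
  qed
  fix i k l assume "steepest \<omega> i k" "steepest \<omega> i l"
  then show "k = l" using wlog by (metis linorder_neqE_nat)
qed

text \<open>A tie along a tree pair \<open>p < q\<close> would make \<open>u (pos q)\<close>
  steepest from \<open>u (pos p)\<close>, as is the vertex at the next smaller index; uniqueness
  identifies them, yet the latter index has a strictly smaller coordinate. Ties between incomparable
  indices remain possible.\<close>

lemma generic_strict:
  assumes g: "generic_direction \<Delta> c \<omega>" and pq: "(p, q) \<in> minimal_pairs (\<theta> \<omega>)" "p \<noteq> q"
  shows "\<theta> \<omega> $ p < \<theta> \<omega> $ q"
proof (rule ccontr)
  assume "\<not> \<theta> \<omega> $ p < \<theta> \<omega> $ q"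
  then have eq: "\<theta> \<omega> $ p = \<theta> \<omega> $ q" using minimal_pairsD[OF pq(1)] by simp
  have wlog: False
    if pq: "p < q" "(p, q) \<in> minimal_pairs (\<theta> \<omega>)" "\<theta> \<omega> $ p = \<theta> \<omega> $ q" for p q
  proof -
    have "steepest \<omega> p (pos q)"
    proof (rule steepest_if_next)
      show "pos p < pos q" using pq(1) by (simp add: pos_less_iff)
      show "pos q \<le> Suc CARD('m)" using pos_bounds(2)[of q] by simp
      show "\<theta> \<omega> $ p \<le> \<theta> \<omega> $ j" if "p < j" "pos j < pos q" for j
      proof -
        have "j \<in> {min p q..max p q}" using pq(1) that by (simp add: pos_less_iff less_imp_le)
        then show ?thesis using pq(2) by (simp add: minimal_pairs_def)
      qed
    qed (use pq in auto)
    moreover have "steepest \<omega> p (next_smaller (\<theta> \<omega>) p)"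
      using tree_cone_self by (rule steepest_next_smaller)
    ultimately have "pos q = next_smaller (\<theta> \<omega>) p" using g by (auto simp: generic_direction_iff)
    then have "\<theta> \<omega> $ q < \<theta> \<omega> $ p"
      using next_smaller_cases[of "\<theta> \<omega>" p] pos_bounds(2)[of q] by (auto simp: pos_eq_iff)
    then show False using pq(3) by simp
  qed
  have "(q, p) \<in> minimal_pairs (\<theta> \<omega>)"
    using pq eq by (simp add: minimal_pairs_def min.commute max.commute)
  then show False using wlog[of p q] wlog[of q p] pq eq by (metis linorder_neqE)
qed

text \<open>The arborescence encodes precisely \<open>next_smaller\<close>, and by
  \<open>generic_strict\<close> the tree of \<open>\<theta> \<omega>\<close> has no ties along it,
  so these right ancestors determine its cone.\<close>

lemma pivot_fiber_eq:
  assumes g: "generic_direction \<Delta> c \<omega>"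
  shows "pivot_fiber \<Delta> c \<omega> = {\<omega>'. generic_direction \<Delta> c \<omega>' \<and> \<theta> \<omega>' \<in> tree_cone (\<theta> \<omega>)}"
proof -
  have arb: "arborescence \<Delta> c \<omega>' (u (pos i)) = u (next_smaller x i)"
    if "generic_direction \<Delta> c \<omega>'" "\<theta> \<omega>' \<in> tree_cone x" for \<omega>' x i
    using that by (intro arborescence_eq steepest_next_smaller)
  have top: "arborescence \<Delta> c \<omega>' (u (Suc CARD('m))) = u (Suc CARD('m))" for \<omega>'
    by (simp add: arborescence_def improving_neighbors_top)
  have "(\<forall>v\<in>vertices \<Delta>. arborescence \<Delta> c \<omega>' v = arborescence \<Delta> c \<omega> v) \<longleftrightarrow> \<theta> \<omega>' \<in> tree_cone (\<theta> \<omega>)"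
    if g': "generic_direction \<Delta> c \<omega>'" for \<omega>'
  proof
    assume eq: "\<forall>v\<in>vertices \<Delta>. arborescence \<Delta> c \<omega>' v = arborescence \<Delta> c \<omega> v"
    have "next_smaller (\<theta> \<omega>') i = next_smaller (\<theta> \<omega>) i" for i
    proof -
      have "u (next_smaller (\<theta> \<omega>') i) = u (next_smaller (\<theta> \<omega>) i)"
        using eq arb[OF g' tree_cone_self] arb[OF g tree_cone_self] by (simp add: all_vertices_iff)
      then show ?thesis
        using u_eq_iff next_smaller_bounds[where i = i and x = "\<theta> \<omega>"] next_smaller_bounds[where i = i and x = "\<theta> \<omega>'"] by simp
    qed
    then show "\<theta> \<omega>' \<in> tree_cone (\<theta> \<omega>)"
      by (intro tree_cone_next_smaller generic_strict[OF g]) auto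
  next
    assume "\<theta> \<omega>' \<in> tree_cone (\<theta> \<omega>)"
    then show "\<forall>v\<in>vertices \<Delta>. arborescence \<Delta> c \<omega>' v = arborescence \<Delta> c \<omega> v"
      using arb[OF g'] arb[OF g tree_cone_self] top by (simp add: all_vertices_iff)
  qed
  then show ?thesis by (auto simp: pivot_fiber_def)
qed

lemma closure_pivot_fiber:
  assumes g: "generic_direction \<Delta> c \<omega>"
  shows "closure (pivot_fiber \<Delta> c \<omega>) = \<theta> -` tree_cone (\<theta> \<omega>)"
proof
  have "closed (\<theta> -` tree_cone (\<theta> \<omega>))"
    by (rule closed_vimage[OF closed_tree_cone continuous])
  then show "closure (pivot_fiber \<Delta> c \<omega>) \<subseteq> \<theta> -` tree_cone (\<theta> \<omega>)"
    by (intro closure_minimal) (auto simp: pivot_fiber_eq[OF g])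
  obtain x where x: "distinct_coords x" "\<And>p q. \<theta> \<omega> $ p < \<theta> \<omega> $ q \<Longrightarrow> x $ p < x $ q"
    using tie_break[of "\<theta> \<omega>"] by blast
  \<comment> \<open>Breaking ties separates only incomparable indices, so both points have the same
    cone, and density can be used for \<open>x\<close>.\<close>
  have "x \<in> tree_cone (\<theta> \<omega>)"
  proof -
    have "x $ p \<le> x $ q" if "(p, q) \<in> minimal_pairs (\<theta> \<omega>)" for p q
      using generic_strict[OF g that] x(2)[of p q] by (cases "p = q") auto
    then show ?thesis by (auto simp: tree_cone_def)
  qed
  moreover have "\<theta> \<omega> \<in> tree_cone x" using x(2) by (rule tie_break_tree_cone)
  ultimately have eq: "tree_cone (\<theta> \<omega>) = tree_cone x"
    by (simp add: tree_cone_subset_iff subset_antisym)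
  have "\<theta> -` tree_cone (\<theta> \<omega>) \<subseteq> \<theta> -` closure {z \<in> tree_cone x. distinct_coords z}"
    using tree_cone_closure_distinct[OF x(1)] eq by blast
  also have "\<dots> = closure (\<theta> -` {z \<in> tree_cone x. distinct_coords z})"
    by (rule closure_vimage[symmetric])
  also have "\<dots> \<subseteq> closure (pivot_fiber \<Delta> c \<omega>)"
    by (intro closure_mono) (auto simp: pivot_fiber_eq[OF g] eq intro: distinct_imp_generic)
  finally show "\<theta> -` tree_cone (\<theta> \<omega>) \<subseteq> closure (pivot_fiber \<Delta> c \<omega>)" .
qed

text \<open>The tree cones of images of generic directions cover the space: a tie-broken point
  \<open>x\<close> equals \<open>\<theta> \<omega>\<close> for some \<omega> by surjectivity, and
  distinct coordinates make \<omega> generic.\<close>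

lemma pivot_fan_eq: "pivot_fan \<Delta> c = (\<lambda>\<sigma>. \<theta> -` \<sigma>) ` range tree_cone"
proof -
  let ?M = "{tree_cone (\<theta> \<omega>) |\<omega>. generic_direction \<Delta> c \<omega>}"
  have "{closure (pivot_fiber \<Delta> c \<omega>) |\<omega>. generic_direction \<Delta> c \<omega>} = (\<lambda>\<sigma>. \<theta> -` \<sigma>) ` ?M"
    using closure_pivot_fiber by (auto simp: image_iff)
  then have "pivot_fan \<Delta> c = (\<lambda>\<sigma>. \<theta> -` \<sigma>) ` fan_of ?M"
    unfolding pivot_fan_def by (simp only:) (rule fan_of_vimage, blast)
  also have "fan_of ?M = range tree_cone"
  proof (rule fan_of_tree_cones)
    show "\<Union>?M = UNIV"
    proof (rule UNIV_eq_I[symmetric])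
      fix y :: "real ^ 'm::{finite,linorder}"
      obtain x where x: "distinct_coords x" "\<And>p q. y $ p < y $ q \<Longrightarrow> x $ p < x $ q"
        using tie_break[of y] by blast
      obtain \<omega> where \<omega>: "x = \<theta> \<omega>" using surj_theta by blast
      have "y \<in> tree_cone x" using x(2) by (rule tie_break_tree_cone)
      then show "y \<in> \<Union>?M" using x(1) \<omega> distinct_imp_generic by blast
    qed
  qed blast
  finally show ?thesis .
qed

end

theorem theorem3p10:
  fixes \<Delta> :: "(real ^ 'm::{finite,linorder}) set"
    and c :: "real ^ 'm::{finite,linorder}"
    and u :: "nat \<Rightarrow> real ^ 'm::{finite,linorder}"
  assumes dim: "CARD('m) \<ge> 2"
    and simplex: "(int CARD('m)) simplex \<Delta>"
    and generic: "\<forall>v\<in>vertices \<Delta>. \<forall>w\<in>vertices \<Delta>. v \<noteq> w \<longrightarrow> c \<bullet> v \<noteq> c \<bullet> w"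
    and labels: "bij_betw u {1..CARD('m) + 1} (vertices \<Delta>)"
    and increasing: "\<forall>i\<in>{1..CARD('m) + 1}. \<forall>j\<in>{1..CARD('m) + 1}. i < j \<longrightarrow> c \<bullet> u i < c \<bullet> u j"
  shows "pl_fan_isomorphism (slope_map \<Delta> c u) (pivot_fan \<Delta> c) sylvester_fan"
proof -
  interpret generic_simplex \<Delta> c u
    by unfold_locales (use dim simplex labels increasing in auto)
  show ?thesis using pl_fan_isomorphism by (simp add: pivot_fan_eq sylvester_fan_eq)
qed

end
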